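(* For every integer $d\ge 3$ and every $u\in(0,1/2]$, \[ i_{E,u}(d)\ \ge\ \widehat A_d(u)=\frac{y_{d,u}}{u}, \] where $y_{d,u}$ is the smallest positive solution $y$ of \[ d^{d/2}u^{(d-1)u}(1-u)^{(d-1)(1-u)}=(du-y)^{(du-y)/2}(d-du-y)^{(d-du-y)/2}y^y . \]
   Context: For a graph $G$ on $n$ vertices with vertex set $V$ and $U\subseteq V$, $\partial_E(U)$ is the set of edges with exactly one endpoint in $U$. For $0<u\le 1/2$, $i_{E,u}(G)=\min |\partial_E(U)|/|U|$ over nonempty $U\subseteq V$ with $|U|\le un$. $\mathcal G_{n,d}$ is the uniform probability space on simple $d$-regular graphs on $n$ (labelled) vertices ($dn$ even; $n\to\infty$ through such $n$). A property holds a.a.s. if its probability tends to $1$ as $n\to\infty$. Define $i_{E,u}(d)=\sup\{\ell : i_{E,u}(\mathcal G_{n,d})\ge \ell \text{ a.a.s.}\}$. With the convention $0\log 0=0$, for $0\le y\le du$ let \[ \begin{aligned} \widehat f_d(u,y)=\ &du\log(du)+(d-du)\log(d-du)-u\log u-(1-u)\log(1-u)-y\log y\\ &-\tfrac12\big((du-y)\log(du-y)+(d-du-y)\log(d-du-y)+d\log d\big), \end{aligned} \] and $\widehat A_d(u)=\frac1u\min\{y:\widehat f_d(u,y)\ge 0\}$. In the displayed equation of the claim, $y$ ranges over $0<y\le du$ (where the expressions are real), with $0^0=1$. *)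

theory Defs
  imports "HOL-Probability.Probability"
begin

text \<open>
  A simple graph with vertex set \<open>V\<close> is given by its edge set \<open>E\<close>, a set of two-element
  subsets of \<open>V\<close>.
\<close>

definition vertex_degree :: "'a set set \<Rightarrow> 'a \<Rightarrow> nat" where
  "vertex_degree E v = card {e \<in> E. v \<in> e}"

definition regular_graphs :: "nat \<Rightarrow> nat \<Rightarrow> nat set set set" where
  "regular_graphs n d =
     {E. E \<subseteq> {e. e \<subseteq> {..<n} \<and> card e = 2} \<and> (\<forall>v\<in>{..<n}. vertex_degree E v = d)}"

definition edge_boundary :: "'a set set \<Rightarrow> 'a set \<Rightarrow> 'a set set" where
  "edge_boundary E U = {e \<in> E. card (e \<inter> U) = 1}"

definition edge_iso_number :: "'a set \<Rightarrow> 'a set set \<Rightarrow> real \<Rightarrow> real" where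
  "edge_iso_number V E u =
     Min {real (card (edge_boundary E U)) / real (card U) | U.
            U \<subseteq> V \<and> U \<noteq> {} \<and> real (card U) \<le> u * real (card V)}"

text \<open>
  The limit is taken along those \<open>n\<close> for which \<open>d * n\<close> is even. For the finitely many such \<open>n\<close>
  without a \<open>d\<close>-regular graph, \<open>pmf_of_set {}\<close> is unspecified; this does not affect the limit.
\<close>

definition aas :: "nat \<Rightarrow> (nat \<Rightarrow> nat set set \<Rightarrow> bool) \<Rightarrow> bool" where
  "aas d P \<longleftrightarrow>
     ((\<lambda>n. measure_pmf.prob (pmf_of_set (regular_graphs n d)) {E. P n E}) \<longlongrightarrow> 1)
       (inf at_top (principal {n. even (d * n)}))"

text \<open>
  The set below contains \<open>0\<close> and, for \<open>u > 0\<close>, is bounded above by \<open>d\<close> (take a single vertex as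
  \<open>U\<close>), so the real supremum is the genuine one.
\<close>

definition edge_iso_const :: "real \<Rightarrow> nat \<Rightarrow> real" where
  "edge_iso_const u d = Sup {l. aas d (\<lambda>n E. l \<le> edge_iso_number {..<n} E u)}"

text \<open>The convention \<open>0 log 0 = 0\<close> holds automatically here.\<close>

definition xlogx :: "real \<Rightarrow> real" where
  "xlogx x = x * ln x"

definition f_hat :: "nat \<Rightarrow> real \<Rightarrow> real \<Rightarrow> real" where
  "f_hat d u y =
     xlogx (real d * u) + xlogx (real d - real d * u) - xlogx u - xlogx (1 - u) - xlogx y
     - 1 / 2 * (xlogx (real d * u - y) + xlogx (real d - real d * u - y) + xlogx (real d))"

definition A_hat :: "nat \<Rightarrow> real \<Rightarrow> real" where
  "A_hat d u = 1 / u * (LEAST y. 0 \<le> y \<and> y \<le> real d * u \<and> f_hat d u y \<ge> 0)"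

text \<open>Real power with \<open>0\<close> to the power \<open>0\<close> equal to \<open>1\<close>; in contrast, \<open>0 powr 0 = 0\<close>.\<close>

definition rpow :: "real \<Rightarrow> real \<Rightarrow> real" where
  "rpow x a = (if a = 0 then 1 else x powr a)"

definition is_solution :: "nat \<Rightarrow> real \<Rightarrow> real \<Rightarrow> bool" where
  "is_solution d u y \<longleftrightarrow>
     rpow (real d) (real d / 2) * rpow u ((real d - 1) * u) * rpow (1 - u) ((real d - 1) * (1 - u))
     = rpow (real d * u - y) ((real d * u - y) / 2) * rpow (real d - real d * u - y) ((real d - real d * u - y) / 2) * rpow y y"

definition is_smallest_positive_solution :: "nat \<Rightarrow> real \<Rightarrow> real \<Rightarrow> bool" where
  "is_smallest_positive_solution d u y \<longleftrightarrow>
     0 < y \<and> y \<le> real d * u \<and> is_solution d u y \<and>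
     (\<forall>z. 0 < z \<and> z \<le> real d * u \<and> is_solution d u z \<longrightarrow> y \<le> z)"

end

theory Submission
  imports Defs "HOL-Real_Asymp.Real_Asymp"
begin

text \<open>
  The bound is a first moment argument. A uniformly random \<open>d\<close>-regular graph on \<open>n\<close> vertices is
  produced from a uniformly random word of length \<open>2m = dn\<close> over the alphabet \<open>{..<n}\<close> in which every
  letter occurs \<open>d\<close> times: the positions are grouped into \<open>m\<close> pairs, and each pair of letters is an
  edge. This is the configuration model with the edges numbered and oriented and with the labels of
  the half-edges at a vertex forgotten.
  Words giving a loop or a repeated edge are discarded. Every simple \<open>d\<close>-regular graph comes from the
  same number of words (\<open>card_representations_le\<close>), and a positive fraction of all words is simple,
  uniformly in \<open>n\<close> (\<open>positive_fraction_simple\<close>). So an event that has probability tending to \<open>0\<close> for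
  random words has probability tending to \<open>0\<close> for random regular graphs.

  That a positive fraction of the words is simple comes from a switching argument. The expected
  number of bad pairs is bounded, so at least half of the words have at most \<open>J\<close> of them, with \<open>J\<close>
  depending on \<open>d\<close> only. Exchanging two letters removes a bad pair in about \<open>m\<close> ways, and at most
  \<open>O(m)\<close> such exchanges lead to the same result, so words with \<open>t \<le> J\<close> bad pairs are outnumbered, up to a
  constant factor, by words with fewer.

  For a fixed set \<open>U\<close> of \<open>k\<close> vertices, the set of positions carrying a letter of \<open>U\<close> is uniform among
  the \<open>dk\<close>-subsets of the \<open>2m\<close> positions (\<open>card_words_pattern_in\<close>), and the edge boundary of \<open>U\<close>
  corresponds to the pairs that this subset splits. Comparing the binomial coefficients involved with
  entropy functions, the expected number of sets of size \<open>k\<close> with boundary of size \<open>y\<close> is at most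
  a polynomial in \<open>n\<close> times \<open>exp (n * f_hat d (k/n) (y/n))\<close> (\<open>expected_count_le\<close>). This is what \<open>f_hat\<close>
  stands for.

  It remains to see that \<open>f_hat\<close> is negative in the required range. In \<open>y\<close> it increases up to
  \<open>d u (1 - u)\<close>; it is negative at \<open>0\<close> and, by convexity of \<open>x ln x\<close>, nonnegative at
  \<open>(d - 2) u (1 - u)\<close>. Hence it has a first zero \<open>y\<close>, which satisfies \<open>y \<le> (d - 2) u (1 - u)\<close>, and
  \<open>A_hat d u = y / u\<close>. If \<open>l < A_hat d u\<close>, then \<open>l \<le> (d - 2)(1 - u)\<close>, and under this condition
  \<open>f_hat d s (l s) / s\<close> is nondecreasing in \<open>s\<close> on \<open>(0, u]\<close> (\<open>f_hat_ratio_mono\<close>). So the single inequality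
  \<open>f_hat d u (l u) < 0\<close> yields \<open>f_hat d s y \<le> - c s\<close> for all \<open>s \<le> u\<close> and \<open>y \<le> l s\<close>: the expected number of
  sets of size \<open>k\<close> is at most a polynomial times \<open>exp (- c k)\<close>, which settles the sets of linear size.
  For small sets the polynomial factor is too expensive. Since \<open>l < d - 2\<close>, such a set spans at
  least \<open>(1 + e) k\<close> edges for some \<open>e > 0\<close>, and a cruder count gives \<open>C^k (k/n)^((1 + e k)/2)\<close>
  (\<open>few_split_small\<close>), which is summable over \<open>k \<le> \<delta> n\<close> with total \<open>O(n^(-1/2))\<close>.
\<close>

section \<open>Analysis of the exponent\<close>

lemma xlogx_0 [simp]: "xlogx 0 = 0" by (simp add: xlogx_def)

lemma xlogx_mult: "a > 0 \<Longrightarrow> x \<ge> 0 \<Longrightarrow> xlogx (a * x) = a * xlogx x + a * x * ln a"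
  by (cases "x = 0") (auto simp: xlogx_def ln_mult algebra_simps)

lemma has_real_derivative_xlogx [derivative_intros]:
  assumes "(f has_real_derivative D) (at x within S)" "f x > 0"
  shows "((\<lambda>x. xlogx (f x)) has_real_derivative ((ln (f x) + 1) * D)) (at x within S)"
  unfolding xlogx_def using assms
  by (auto intro!: derivative_eq_intros simp: field_simps)

lemma continuous_on_xlogx: "continuous_on {0..} xlogx"
  unfolding continuous_on_eq_continuous_within
proof
  fix x :: real assume "x \<in> {0..}"
  show "continuous (at x within {0..}) xlogx"
  proof (cases "x = 0")
    case True
    have "(xlogx \<longlongrightarrow> 0) (at_right 0)" unfolding xlogx_def by real_asymp
    moreover have "at 0 within {0..} = at_right (0::real)"
      by (rule at_within_nhd[of _ UNIV]) auto
    ultimately show ?thesis using True by (simp add: continuous_within)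
  next
    case False
    with \<open>x \<in> {0..}\<close> have "x > 0" by auto
    then have "(xlogx has_real_derivative (ln x + 1) * 1) (at x within {0..})"
      by (intro has_real_derivative_xlogx[where f = "\<lambda>x. x"]) auto
    then show ?thesis by (rule DERIV_continuous)
  qed
qed

lemma continuous_on_xlogx' [continuous_intros]:
  assumes "continuous_on S f" "\<And>x. x \<in> S \<Longrightarrow> f x \<ge> 0"
  shows "continuous_on S (\<lambda>x. xlogx (f x))"
  using continuous_on_compose2[OF continuous_on_xlogx assms(1)] assms(2) by auto

text \<open>Convexity of \<open>x ln x\<close> in the form in which it is used: its increments over a fixed step grow.\<close>

lemma xlogx_increment_mono:
  assumes "0 \<le> x" "x \<le> y" "0 \<le> t"
  shows "xlogx (x + t) - xlogx x \<le> xlogx (y + t) - xlogx y"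
proof (cases "x = y \<or> t = 0")
  case False
  with assms have xy: "x < y" "t > 0" by auto
  have "xlogx (x + t) - xlogx x \<le> xlogx (y + t) - xlogx y"
  proof (rule DERIV_nonneg_imp_increasing_open[of x y "\<lambda>z. xlogx (z + t) - xlogx z"])
    show "continuous_on {x..y} (\<lambda>z. xlogx (z + t) - xlogx z)"
      using assms by (intro continuous_intros) auto
    fix z assume z: "x < z" "z < y"
    have "((\<lambda>z. xlogx (z + t) - xlogx z) has_real_derivative
            (ln (z + t) + 1) * (1 + 0) - (ln z + 1) * 1) (at z)"
      using z assms by (intro derivative_intros) auto
    moreover have "(ln (z + t) + 1) * (1 + 0) - (ln z + 1) * 1 \<ge> 0"
      using z assms by simp
    ultimately show "\<exists>D. ((\<lambda>z. xlogx (z + t) - xlogx z) has_real_derivative D) (at z) \<and> 0 \<le> D"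
      by blast
  qed (use xy in auto)
  then show ?thesis .
qed auto

lemma f_hat_continuous:
  assumes "0 < s" "s \<le> 1/2"
  shows "continuous_on {0..real d * s} (f_hat d s)"
proof -
  have "real d * s \<le> real d - real d * s"
    using mult_left_mono[of "2 * s" 1 "real d"] assms by (simp add: algebra_simps)
  then have "y \<le> real d - real d * s" if "y \<in> {0..real d * s}" for y
    using that unfolding atLeastAtMost_iff by linarith
  then show ?thesis
    unfolding f_hat_def
    by (intro continuous_on_diff continuous_on_add continuous_on_mult continuous_on_const
          continuous_on_id continuous_on_xlogx') auto
qed

text \<open>
  The derivative in \<open>y\<close> is half of \<open>ln ((d s - y) (d - d s - y)) - ln (y^2)\<close>, and the quadratic
  terms cancel in \<open>(d s - y) (d - d s - y) - y^2 = d (d s (1 - s) - y)\<close>.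
\<close>

lemma f_hat_strict_mono:
  assumes "d > 0" "0 < s" "s \<le> 1/2" "0 \<le> y" "y < z" "z \<le> real d * s * (1 - s)"
  shows "f_hat d s y < f_hat d s z"
proof (rule DERIV_pos_imp_increasing_open[OF \<open>y < z\<close>])
  have le: "real d * s * (1 - s) < real d * s" "real d * s * (1 - s) < real d * (1 - s)"
    using assms by auto
  have "{y..z} \<subseteq> {0..real d * s}"
    using assms(4,6) le(1) by auto
  then show "continuous_on {y..z} (f_hat d s)"
    by (rule continuous_on_subset[OF f_hat_continuous[OF assms(2,3)]])
  fix x assume x: "y < x" "x < z"
  define a where "a = real d * s - x"
  define b where "b = real d - real d * s - x"
  have pos: "x > 0" "a > 0" "b > 0"
  proof -
    have "real d * (1 - s) = real d - real d * s" by (simp add: algebra_simps)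
    then show "x > 0" "a > 0" "b > 0"
      using x assms(4,6) le unfolding a_def b_def by linarith+
  qed
  have "(f_hat d s has_real_derivative
          (0 - (ln x + 1) * 1) - 1/2 * ((ln a + 1) * (0 - 1) + (ln b + 1) * (0 - 1) + 0)) (at x)"
    using pos unfolding a_def b_def f_hat_def by (intro derivative_intros DERIV_cmult) auto
  also have "(0 - (ln x + 1) * 1) - 1/2 * ((ln a + 1) * (0 - 1) + (ln b + 1) * (0 - 1) + 0)
      = (ln (a * b) - ln (x * x)) / 2"
    using ln_mult_pos[of a b] ln_mult_pos[of x x] pos by (simp add: field_simps)
  finally have D: "(f_hat d s has_real_derivative (ln (a * b) - ln (x * x)) / 2) (at x)" .
  have "a * b - x * x = real d * (real d * s * (1 - s) - x)"
    by (simp add: a_def b_def algebra_simps)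
  also have "\<dots> > 0" using assms x by simp
  finally have "ln (a * b) > ln (x * x)" using pos by simp
  with D show "\<exists>D. (f_hat d s has_real_derivative D) (at x) \<and> 0 < D"
    by (intro exI conjI) auto
qed

lemma f_hat_mono:
  assumes "d > 0" "0 < s" "s \<le> 1/2" "0 \<le> y" "y \<le> z" "z \<le> real d * s * (1 - s)"
  shows "f_hat d s y \<le> f_hat d s z"
  using f_hat_strict_mono[OF assms(1-4), of z] assms by (cases "y = z") auto

text \<open>At \<open>y = 0\<close> the function is \<open>- (d / 2 - 1)\<close> times the binary entropy of \<open>u\<close>.\<close>

lemma f_hat_0_neg:
  assumes "d \<ge> 3" "0 < u" "u \<le> 1/2"
  shows "f_hat d u 0 < 0"
proof -
  have "f_hat d u 0 = (real d / 2 - 1) * (u * ln u + (1 - u) * ln (1 - u))"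
  proof -
    have *: "real d - real d * u = real d * (1 - u)" by (simp add: algebra_simps)
    show ?thesis using assms unfolding f_hat_def *
      by (simp add: xlogx_mult, simp add: xlogx_def algebra_simps)
         (simp add: field_simps)
  qed
  moreover have "u * ln u < 0" "(1 - u) * ln (1 - u) < 0"
    using assms by (auto simp: mult_pos_neg)
  moreover have "real d / 2 - 1 > 0" using assms by simp
  ultimately show ?thesis
    by (simp only: mult_pos_neg add_neg_neg)
qed

text \<open>
  With \<open>v = 1 - u\<close> and \<open>D = d - 2\<close>, the point \<open>y = D u v\<close> makes \<open>d u - y = u (D u + 2)\<close> and
  \<open>d v - y = v (D v + 2)\<close>. For \<open>X = xlogx\<close>, twice the value of \<open>f_hat\<close> is then the average, with
  weights \<open>u\<close> and \<open>v\<close>, of the two numbers \<open>(X (D + 2) - X D) - (X (D x + 2) - X (D x))\<close> for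
  \<open>x = u\<close> and \<open>x = v\<close>. Both are nonnegative because \<open>X\<close> is convex and \<open>x \<le> 1\<close>.
\<close>

lemma f_hat_nonneg_at:
  assumes "d \<ge> 3" "0 < u" "u \<le> 1/2"
  shows "f_hat d u ((real d - 2) * u * (1 - u)) \<ge> 0"
proof -
  define D where "D = real d - 2"
  define v where "v = 1 - u"
  have D: "D > 0" "real d = D + 2" using assms by (auto simp: D_def)
  have v: "v > 0" "u + v = 1" using assms by (auto simp: v_def)
  have conv: "xlogx (D * x + 2) - xlogx (D * x) \<le> xlogx (D + 2) - xlogx D" if "0 < x" "x \<le> 1" for x
    using xlogx_increment_mono[of "D * x" D 2] that D by auto
  have lns: "ln (D * u * v) = ln D + ln u + ln v" "ln (D * u) = ln D + ln u" "ln (D * v) = ln D + ln v"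
    using D v assms by (auto simp: ln_mult)
  have a1: "real d * u = (D + 2) * u" "real d - real d * u = (D + 2) * v"
    using D v by (auto simp: algebra_simps v_def)
  have a2: "(D + 2) * u - D * u * v = u * (D * u + 2)" "(D + 2) * v - D * u * v = v * (D * v + 2)"
    by (auto simp: v_def algebra_simps)
  define L1 L2 where "L1 = ln (D * u + 2)" and "L2 = ln (D * v + 2)"
  have f: "f_hat d u (D * u * v) = (D + 2) * u * (ln (D+2) + ln u) + (D+2) * v * (ln (D+2) + ln v)
     - u * ln u - v * ln v - D * u * v * (ln D + ln u + ln v)
     - 1/2 * (u * (D * u + 2) * (ln u + L1) + v * (D * v + 2) * (ln v + L2) + (D + 2) * ln (D+2))"
  proof -
    have ln2: "ln ((D + 2) * u) = ln (D + 2) + ln u" "ln ((D + 2) * v) = ln (D + 2) + ln v"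
      "ln (u * (D * u + 2)) = ln u + L1" "ln (v * (D * v + 2)) = ln v + L2"
      unfolding L1_def L2_def using D v assms by (auto intro!: ln_mult_pos mult_pos_pos add_pos_pos)
    have a3: "D + 2 - (D + 2) * u = (D + 2) * v" "(D + 2) * v - D * u * v = v * (D * v + 2)"
      by (auto simp: v_def algebra_simps)
    show ?thesis
      unfolding f_hat_def a1 a2 unfolding D(2) v_def[symmetric] xlogx_def lns a3 ln2 ..
  qed
  have k1: "(D * u + 2) * L1 - D * u * (ln D + ln u) \<le> (D + 2) * ln (D + 2) - D * ln D"
    using conv[of u] assms lns by (simp add: xlogx_def L1_def)
  have k2: "(D * v + 2) * L2 - D * v * (ln D + ln v) \<le> (D + 2) * ln (D + 2) - D * ln D"
    using conv[of v] v assms lns by (simp add: xlogx_def L2_def)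
  have "(D + 2) * u * (ln (D+2) + ln u) + (D+2) * v * (ln (D+2) + ln v)
     - u * ln u - v * ln v - D * u * v * (ln D + ln u + ln v)
     - 1/2 * (u * (D * u + 2) * (ln u + L1) + v * (D * v + 2) * (ln v + L2) + (D + 2) * ln (D+2))
    = 1/2 * (u * ((D + 2) * ln (D + 2) - D * ln D - ((D * u + 2) * L1 - D * u * (ln D + ln u)))
           + v * ((D + 2) * ln (D + 2) - D * ln D - ((D * v + 2) * L2 - D * v * (ln D + ln v))))"
    unfolding v_def by (simp add: field_simps)
  with f have "f_hat d u (D * u * v) = 1/2 * (u * ((D + 2) * ln (D + 2) - D * ln D - ((D * u + 2) * L1 - D * u * (ln D + ln u)))
           + v * ((D + 2) * ln (D + 2) - D * ln D - ((D * v + 2) * L2 - D * v * (ln D + ln v))))"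
    by (simp only:)
  also have "\<dots> \<ge> 0"
    using v assms k1 k2 by (intro mult_nonneg_nonneg add_nonneg_nonneg) linarith+
  finally have "f_hat d u (D * u * v) \<ge> 0" .
  then show ?thesis by (simp add: D_def v_def)
qed

text \<open>
  The derivative of \<open>s \<mapsto> f_hat d s (l s) / s\<close>, multiplied by \<open>s^2\<close>, collapses to
  \<open>(d/2) ln (1 - s - l s / d) - (d - 1) ln (1 - s)\<close>. With \<open>p = (d - 2) / d\<close> the bound on \<open>l\<close> gives
  \<open>1 - s - l s / d \<ge> (1 - s) (1 - p s)\<close>, and \<open>1 - p s \<ge> (1 - s)^p\<close> by the inequality of weighted means;
  as \<open>(d/2) (1 + p) = d - 1\<close>, the derivative is nonnegative.
\<close>

lemma f_hat_ratio_mono: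
  assumes "d \<ge> 3" "0 < l" "l \<le> (real d - 2) * (1 - u)" "0 < s" "s \<le> u" "u \<le> 1/2"
  shows "f_hat d s (l * s) / s \<le> f_hat d u (l * u) / u"
proof (rule DERIV_nonneg_imp_nondecreasing[OF \<open>s \<le> u\<close>])
  fix x assume x: "s \<le> x" "x \<le> u"
  define p where "p = (real d - 2) / real d"
  have p: "0 < p" "p < 1" "real d * p = real d - 2" using assms by (auto simp: p_def)
  have x0: "0 < x" "x \<le> 1/2" using x assms by auto
  have lx: "l \<le> (real d - 2) * (1 - x)"
    by (rule order_trans[OF assms(3)], rule mult_left_mono) (use x assms(1) in auto)
  have le: "real d * ((1 - x) * (1 - p * x)) \<le> real d - real d * x - l * x"
  proof -
    have "real d * ((1 - x) * (1 - p * x)) = (1 - x) * (real d - real d * p * x)"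
      by (simp add: algebra_simps)
    also have "\<dots> = real d - real d * x - ((real d - 2) * (1 - x)) * x"
      unfolding p by (simp add: algebra_simps)
    also have "\<dots> \<le> real d - real d * x - l * x"
      using lx x0 by (simp add: mult_right_mono)
    finally show ?thesis .
  qed
  have px: "p * x < 1" using mult_strict_mono[of p 1 x 1] p x0 by simp
  have pos0: "(1 - x) * (1 - p * x) > 0" using px x0 by simp
  have pos3: "real d - real d * x - l * x > 0"
  proof -
    have "0 < real d * ((1 - x) * (1 - p * x))" using pos0 assms(1) by simp
    with le show ?thesis by linarith
  qed
  have l: "l < real d"
  proof -
    have "(real d - 2) * (1 - x) \<le> (real d - 2) * 1"
      using x0 assms by (intro mult_left_mono) auto
    with lx show ?thesis by simp
  qed
  have pos: "real d * x > 0" "real d - real d * x > 0" "1 - x > 0" "l * x > 0" "real d * x - l * x > 0"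
    using x0 assms l pos3 by (auto intro!: mult_pos_pos simp: algebra_simps)
  define L where "L = real d - real d * x - l * x"
  have LN: "ln (real d * x) = ln (real d) + ln x" "ln (real d - real d * x) = ln (real d) + ln (1 - x)"
    using ln_mult[of "real d" x] ln_mult[of "real d" "1 - x"] x0 assms by (auto simp: algebra_simps)
  let ?g' = "(ln (real d * x) + 1) * (real d * 1) + (ln (real d - real d * x) + 1) * (0 - real d * 1)
             - (ln x + 1) * 1 - (ln (1 - x) + 1) * (0 - 1) - (ln (l * x) + 1) * (l * 1)
             - 1/2 * ((ln (real d * x - l * x) + 1) * (real d * 1 - l * 1)
                      + (ln L + 1) * (0 - real d * 1 - l * 1) + 0)"
  have g: "((\<lambda>s. f_hat d s (l * s)) has_real_derivative ?g') (at x)"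
    unfolding f_hat_def L_def
    using pos pos3 x0 by (intro derivative_intros DERIV_cmult DERIV_ident)
  have "((\<lambda>s. f_hat d s (l * s) / s) has_real_derivative
          (?g' * x - f_hat d x (l * x) * 1) / (x * x)) (at x)"
    using x0 by (intro DERIV_divide g) auto
  moreover have "?g' * x - f_hat d x (l * x) * 1
      = real d / 2 * (ln L - ln (real d)) - (real d - 1) * ln (1 - x)"
  proof -
    \<comment> \<open>The logarithms are treated as independent unknowns: \<open>A\<close>, \<open>B\<close>, \<open>C\<close> for those of \<open>d\<close>, \<open>x\<close>, \<open>1 - x\<close>.\<close>
    have alg: "((A + B + 1) * (r * 1) + (A + C + 1) * (0 - r * 1) - (B + 1) * 1 - (C + 1) * (0 - 1)
               - (E + 1) * (l * 1) - 1/2 * ((F + 1) * (r * 1 - l * 1) + (G + 1) * (0 - r * 1 - l * 1) + 0)) * x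
             - (r * x * (A + B) + (r - r * x) * (A + C) - x * B - (1 - x) * C - l * x * E
                - 1/2 * ((r * x - l * x) * F + (r - r * x - l * x) * G + r * A)) * 1
             = r / 2 * (G - A) - (r - 1) * C" for A B C E F G r :: real
    proof -
      have *: "(1/2) * p = p / 2" for p :: real by simp
      show ?thesis
        by (simp add: * add_divide_distrib diff_divide_distrib ring_distribs)
    qed
    show ?thesis
      unfolding f_hat_def xlogx_def L_def[symmetric] LN
      by (rule alg[where r = "real d", folded L_def])
  qed
  moreover have "real d / 2 * (ln L - ln (real d)) - (real d - 1) * ln (1 - x) \<ge> 0"
  proof -
    have "(1 - x) powr p * 1 powr (1 - p) \<le> p * (1 - x) + (1 - p) * 1"
      by (rule Youngs_inequality_0) (use p x0 in auto)
    then have "(1 - x) powr p \<le> 1 - p * x" using x0 by (simp add: algebra_simps)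
    then have "ln ((1 - x) powr p) \<le> ln (1 - p * x)"
      using x0 px by (subst ln_le_cancel_iff) auto
    then have 1: "p * ln (1 - x) \<le> ln (1 - p * x)" using x0 by (simp add: ln_powr)
    have "ln (real d * ((1 - x) * (1 - p * x))) \<le> ln L"
      using le pos3 pos0 assms unfolding L_def by (subst ln_le_cancel_iff) auto
    then have "ln (real d) + ln (1 - x) + ln (1 - p * x) \<le> ln L"
      using assms x0 px by (simp add: ln_mult)
    with 1 have "ln L - ln (real d) \<ge> (1 + p) * ln (1 - x)" by (simp add: algebra_simps)
    then have "real d / 2 * (ln L - ln (real d)) \<ge> real d / 2 * ((1 + p) * ln (1 - x))"
      by (intro mult_left_mono) auto
    also have "real d / 2 * ((1 + p) * ln (1 - x)) = (real d + real d * p) / 2 * ln (1 - x)"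
      by (simp add: algebra_simps)
    also have "\<dots> = (real d - 1) * ln (1 - x)" unfolding p by simp
    finally show ?thesis by simp
  qed
  ultimately show "\<exists>D. ((\<lambda>s. f_hat d s (l * s) / s) has_real_derivative D) (at x) \<and> 0 \<le> D"
    using x0 by (intro exI conjI) auto
qed

lemma rpow_self:
  assumes "x \<ge> 0" "c \<noteq> 0"
  shows "rpow x (x * c) = exp (c * xlogx x)"
  using assms by (auto simp: rpow_def xlogx_def powr_def algebra_simps)

text \<open>The equation of the claim is \<open>f_hat d u y = 0\<close> after taking logarithms.\<close>

lemma is_solution_iff_f_hat:
  assumes "d \<ge> 3" "0 < u" "u \<le> 1/2" "0 < y" "y \<le> real d * u"
  shows "is_solution d u y \<longleftrightarrow> f_hat d u y = 0"
proof -
  have "real d * u \<le> real d * (1 - u)" using assms by (intro mult_left_mono) auto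
  also have "\<dots> = real d - real d * u" by (simp add: algebra_simps)
  finally have nn: "real d - real d * u - y \<ge> 0" "real d * u - y \<ge> 0"
    using assms(5) by linarith+
  have "rpow (real d) (real d / 2) = exp (1/2 * xlogx (real d))"
    using rpow_self[of "real d" "1/2"] by simp
  moreover have "rpow u ((real d - 1) * u) = exp ((real d - 1) * xlogx u)"
    using rpow_self[of u "real d - 1"] assms by (simp add: mult.commute)
  moreover have "rpow (1 - u) ((real d - 1) * (1 - u)) = exp ((real d - 1) * xlogx (1 - u))"
    using rpow_self[of "1 - u" "real d - 1"] assms by (simp add: mult.commute)
  moreover have "rpow (real d * u - y) ((real d * u - y) / 2) = exp (1/2 * xlogx (real d * u - y))"
    using rpow_self[of "real d * u - y" "1/2"] nn by simp
  moreover have "rpow (real d - real d * u - y) ((real d - real d * u - y) / 2)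
      = exp (1/2 * xlogx (real d - real d * u - y))"
    using rpow_self[of "real d - real d * u - y" "1/2"] nn by simp
  moreover have "rpow y y = exp (xlogx y)"
    using rpow_self[of y 1] assms by simp
  ultimately have "is_solution d u y \<longleftrightarrow>
     1/2 * xlogx (real d) + (real d - 1) * xlogx u + (real d - 1) * xlogx (1 - u)
     = 1/2 * xlogx (real d * u - y) + 1/2 * xlogx (real d - real d * u - y) + xlogx y"
    unfolding is_solution_def by (simp flip: exp_add)
  moreover have "xlogx (real d * u) + xlogx (real d - real d * u)
      = real d * xlogx u + real d * xlogx (1 - u) + xlogx (real d)"
    using xlogx_mult[of "real d" u] xlogx_mult[of "real d" "1 - u"] assms
    by (simp add: algebra_simps) (simp add: xlogx_def algebra_simps)
  ultimately show ?thesis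
    unfolding f_hat_def by (simp add: algebra_simps)
qed

text \<open>
  By strict monotonicity the first zero of \<open>f_hat d u\<close> is at once the first point where it is
  nonnegative and the smallest positive solution.
\<close>

lemma smallest_solution:
  assumes "d \<ge> 3" "0 < u" "u \<le> 1/2"
  obtains y where "is_smallest_positive_solution d u y" "A_hat d u = y / u"
    "0 < y" "y \<le> (real d - 2) * u * (1 - u)" "f_hat d u y = 0"
proof -
  define z where "z = (real d - 2) * u * (1 - u)"
  have z0: "0 < z" using assms by (simp add: z_def)
  have zle: "z \<le> real d * u * (1 - u)" unfolding z_def using assms by (intro mult_right_mono) auto
  also have "\<dots> < real d * u" using assms by (simp add: field_simps)
  finally have zle': "z < real d * u" .
  have "\<exists>y\<ge>0. y \<le> z \<and> f_hat d u y = 0"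
    using f_hat_0_neg[OF assms] f_hat_nonneg_at[OF assms] z0 zle'
    by (intro IVT' continuous_on_subset[OF f_hat_continuous[of u d]] assms) (auto simp: z_def)
  then obtain y where y: "0 \<le> y" "y \<le> z" "f_hat d u y = 0" by blast
  have y0: "y > 0" using y f_hat_0_neg[OF assms] by (cases "y = 0") auto
  have least: "y \<le> x" if "0 \<le> x" "f_hat d u x \<ge> 0" for x
  proof (rule ccontr)
    assume "\<not> y \<le> x"
    then have "f_hat d u x < f_hat d u y"
      using that y zle assms by (intro f_hat_strict_mono) auto
    with y that show False by simp
  qed
  have "(LEAST y. 0 \<le> y \<and> y \<le> real d * u \<and> f_hat d u y \<ge> 0) = y"
    using y zle' by (intro Least_equality) (auto intro: least)
  then have "A_hat d u = y / u" by (simp add: A_hat_def)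
  moreover have "is_smallest_positive_solution d u y"
    unfolding is_smallest_positive_solution_def
    using y y0 zle' is_solution_iff_f_hat[OF assms] by (auto intro: least)
  ultimately show ?thesis using that y y0 by (simp add: z_def)
qed

text \<open>
  The uniform negativity that drives the first moment bound. The constant is
  \<open>c = - f_hat d u (l u) / u\<close>; monotonicity of the ratio transfers it from \<open>u\<close> to all smaller \<open>s\<close>.
\<close>

lemma f_hat_linear_bound:
  assumes "d \<ge> 3" "0 < u" "u \<le> 1/2" "0 < l" "l < A_hat d u"
  obtains c where "c > 0" "\<And>s y. 0 < s \<Longrightarrow> s \<le> u \<Longrightarrow> 0 \<le> y \<Longrightarrow> y \<le> l * s \<Longrightarrow> f_hat d s y \<le> - c * s"
    "l < real d - 2"
proof -
  obtain y0 where y0: "A_hat d u = y0 / u" "0 < y0" "y0 \<le> (real d - 2) * u * (1 - u)"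
    "f_hat d u y0 = 0" using smallest_solution[OF assms(1-3)] by metis
  have lu: "l * u < y0" using assms y0 by (simp add: field_simps)
  have "l * u \<le> ((real d - 2) * (1 - u)) * u" using lu y0 by (simp add: algebra_simps)
  then have l: "l \<le> (real d - 2) * (1 - u)" using assms by simp
  have dle: "(real d - 2) * (1 - u) \<le> real d * (1 - u)" using assms by (intro mult_right_mono) auto
  define c where "c = - (f_hat d u (l * u) / u)"
  have "f_hat d u (l * u) < f_hat d u y0"
  proof (intro f_hat_strict_mono)
    have "y0 \<le> ((real d - 2) * (1 - u)) * u" using y0 by (simp add: algebra_simps)
    also have "\<dots> \<le> (real d * (1 - u)) * u" using dle assms by (intro mult_right_mono) auto
    finally show "y0 \<le> real d * u * (1 - u)" by (simp add: algebra_simps)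
  qed (use assms lu y0 in auto)
  then have "c > 0" using y0 assms by (simp add: c_def divide_less_0_iff)
  moreover have "f_hat d s y \<le> - c * s" if "0 < s" "s \<le> u" "0 \<le> y" "y \<le> l * s" for s y
  proof -
    have "(real d - 2) * (1 - u) \<le> real d * (1 - s)"
      using that assms by (intro mult_mono) auto
    then have "l \<le> real d * (1 - s)" using l by simp
    then have "l * s \<le> real d * s * (1 - s)"
      using that mult_right_mono[of l "real d * (1 - s)" s] by (simp add: algebra_simps)
    then have "f_hat d s y \<le> f_hat d s (l * s)"
      using that assms by (intro f_hat_mono) auto
    also have "f_hat d s (l * s) / s \<le> f_hat d u (l * u) / u"
      using assms that l by (intro f_hat_ratio_mono) auto
    then have "f_hat d s (l * s) \<le> - c * s"
      using that by (simp add: c_def field_simps)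
    finally show ?thesis .
  qed
  moreover have "l < real d - 2"
  proof -
    have "(real d - 2) * (1 - u) < (real d - 2) * 1"
      using assms by (intro mult_strict_left_mono) auto
    with l show ?thesis by simp
  qed
  ultimately show ?thesis using that by blast
qed

section \<open>Patterns of positions and binomial estimates\<close>

text \<open>Position \<open>(i, b)\<close> is one of the two ends of the \<open>i\<close>-th pair.\<close>

definition positions :: "nat \<Rightarrow> (nat \<times> bool) set" where
  "positions m = {..<m} \<times> UNIV"

definition full_pairs :: "nat \<Rightarrow> (nat \<times> bool) set \<Rightarrow> nat set" where
  "full_pairs m S = {i\<in>{..<m}. (i, False) \<in> S \<and> (i, True) \<in> S}"

definition split_pairs :: "nat \<Rightarrow> (nat \<times> bool) set \<Rightarrow> nat set" where
  "split_pairs m S = {i\<in>{..<m}. ((i, False) \<in> S) \<noteq> ((i, True) \<in> S)}"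

lemma finite_positions [simp]: "finite (positions m)"
  by (simp add: positions_def)

lemma card_positions [simp]: "card (positions m) = 2 * m"
  by (simp add: positions_def card_cartesian_product)

lemma finite_pairs [simp]: "finite (full_pairs m S)" "finite (split_pairs m S)"
  by (auto simp: full_pairs_def split_pairs_def)

lemma card_pattern:
  assumes "S \<subseteq> positions m"
  shows "card S = 2 * card (full_pairs m S) + card (split_pairs m S)"
proof -
  let ?F = "full_pairs m S \<times> (UNIV :: bool set)"
  let ?C = "(\<lambda>i. (i, (i, True) \<in> S)) ` split_pairs m S"
  have "S = ?F \<union> ?C"
  proof (intro set_eqI iffI)
    fix p assume p: "p \<in> S"
    obtain i b where ib: "p = (i, b)" by (cases p)
    have "i < m" using p ib assms by (auto simp: positions_def)
    then show "p \<in> ?F \<union> ?C" using p ib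
      by (cases b; cases "(i, \<not> b) \<in> S") (auto simp: full_pairs_def split_pairs_def)
  next
    fix p assume "p \<in> ?F \<union> ?C"
    then consider i b where "p = (i, b)" "i \<in> full_pairs m S"
      | i where "p = (i, (i, True) \<in> S)" "i \<in> split_pairs m S" by auto
    then show "p \<in> S"
    proof cases
      case 1
      then show ?thesis by (cases b) (auto simp: full_pairs_def)
    next
      case 2
      then show ?thesis by (cases "(i, True) \<in> S") (auto simp: split_pairs_def)
    qed
  qed
  moreover have "card (?F \<union> ?C) = card ?F + card ?C"
    by (rule card_Un_disjoint) (auto simp: full_pairs_def split_pairs_def)
  moreover have "card ?C = card (split_pairs m S)"
    by (rule card_image) (auto simp: inj_on_def)
  ultimately show ?thesis by (simp add: card_cartesian_product)
qed

definition patterns :: "nat \<Rightarrow> nat \<Rightarrow> (nat \<times> bool) set set" where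
  "patterns m K = {S. S \<subseteq> positions m \<and> card S = K}"

lemma finite_patterns [simp]: "finite (patterns m K)"
  by (rule finite_subset[of _ "Pow (positions m)"]) (auto simp: patterns_def)

lemma card_patterns: "card (patterns m K) = (2 * m) choose K"
  using n_subsets[of "positions m" K] by (simp add: patterns_def)

text \<open>
  A pattern is determined by the pairs that it splits, by the end that it contains of each of them,
  and by the pairs that it contains completely.
\<close>

lemma card_patterns_split_le:
  "card {S \<in> patterns m K. card (split_pairs m S) = y}
     \<le> (m choose y) * 2 ^ y * ((m - y) choose ((K - y) div 2))"
proof -
  define B where "B = (SIGMA Y : {Y. Y \<subseteq> {..<m} \<and> card Y = y}.
      Pow Y \<times> {F. F \<subseteq> {..<m} - Y \<and> card F = (K - y) div 2})"
  define \<phi> where "\<phi> S = (split_pairs m S, {i \<in> split_pairs m S. (i, True) \<in> S}, full_pairs m S)" for S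
  have fin: "finite {Y. Y \<subseteq> {..<m} \<and> card Y = y}"
    by (rule finite_subset[of _ "Pow {..<m}"]) auto
  have fin2: "finite (Pow Y \<times> {F. F \<subseteq> {..<m} - Y \<and> card F = (K - y) div 2})" if "Y \<subseteq> {..<m}" for Y
  proof -
    have "finite Y" by (rule finite_subset[OF that]) simp
    moreover have "finite {F. F \<subseteq> {..<m} - Y \<and> card F = (K - y) div 2}"
      by (rule finite_subset[of _ "Pow {..<m}"]) auto
    ultimately show ?thesis by simp
  qed
  have "card {S \<in> patterns m K. card (split_pairs m S) = y} \<le> card B"
  proof (rule card_inj_on_le[of \<phi>])
    show "inj_on \<phi> {S \<in> patterns m K. card (split_pairs m S) = y}"
    proof (rule inj_onI)
      fix S T assume S: "S \<in> {S \<in> patterns m K. card (split_pairs m S) = y}"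
        and T: "T \<in> {S \<in> patterns m K. card (split_pairs m S) = y}" and eq: "\<phi> S = \<phi> T"
      from eq have e1: "split_pairs m S = split_pairs m T" and e3: "full_pairs m S = full_pairs m T"
        and e2: "{i \<in> split_pairs m S. (i, True) \<in> S} = {i \<in> split_pairs m T. (i, True) \<in> T}"
        by (auto simp: \<phi>_def)
      have "((i, b) \<in> S) = ((i, b) \<in> T)" if "i < m" for i b
      proof (cases "i \<in> split_pairs m S")
        case True
        then have "((i, True) \<in> S) = ((i, True) \<in> T)" using e1 e2 by blast
        moreover have "((i, False) \<in> S) = ((i, False) \<in> T)"
          using True e1 calculation by (auto simp: split_pairs_def)
        ultimately show ?thesis by (cases b) auto
      next
        case False
        then have "((i, True) \<in> S) = ((i, False) \<in> S)" "((i, True) \<in> T) = ((i, False) \<in> T)"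
          using e1 that by (auto simp: split_pairs_def)
        moreover have "(i \<in> full_pairs m S) = (i \<in> full_pairs m T)" using e3 by simp
        then have "((i, False) \<in> S \<and> (i, True) \<in> S) = ((i, False) \<in> T \<and> (i, True) \<in> T)"
          using that by (simp add: full_pairs_def)
        ultimately show ?thesis by (cases b) auto
      qed
      moreover have "S \<subseteq> positions m" "T \<subseteq> positions m" using S T by (auto simp: patterns_def)
      ultimately show "S = T" by (auto simp: positions_def)
    qed
    show "\<phi> ` {S \<in> patterns m K. card (split_pairs m S) = y} \<subseteq> B"
    proof (rule image_subsetI)
      fix S assume "S \<in> {S \<in> patterns m K. card (split_pairs m S) = y}"
      then have S: "S \<in> patterns m K" and y: "y = card (split_pairs m S)" by auto
      have "K = 2 * card (full_pairs m S) + card (split_pairs m S)"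
        using card_pattern[of S m] S by (auto simp: patterns_def)
      then have "card (full_pairs m S) = (K - card (split_pairs m S)) div 2" by simp
      then show "\<phi> S \<in> B"
        unfolding B_def \<phi>_def using y by (auto simp: split_pairs_def full_pairs_def)
    qed
    show "finite B" unfolding B_def by (rule finite_SigmaI[OF fin], rule fin2) simp
  qed
  also have "card B = (\<Sum>Y\<in>{Y. Y \<subseteq> {..<m} \<and> card Y = y}.
      card (Pow Y \<times> {F. F \<subseteq> {..<m} - Y \<and> card F = (K - y) div 2}))"
    unfolding B_def
  proof (rule card_SigmaI[OF fin], rule ballI)
    fix Y assume "Y \<in> {Y. Y \<subseteq> {..<m} \<and> card Y = y}"
    then show "finite (Pow Y \<times> {F. F \<subseteq> {..<m} - Y \<and> card F = (K - y) div 2})"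
      by (intro fin2) simp
  qed
  also have "\<dots> = (\<Sum>Y\<in>{Y. Y \<subseteq> {..<m} \<and> card Y = y}.
      2 ^ y * ((m - y) choose ((K - y) div 2)))"
  proof (rule sum.cong[OF refl])
      fix Y assume Y: "Y \<in> {Y. Y \<subseteq> {..<m} \<and> card Y = y}"
      then have "Y \<subseteq> {..<m}" by simp
      then have fY: "finite Y" by (rule finite_subset) simp
      have "card ({..<m} - Y) = m - y" using Y fY by (auto simp: card_Diff_subset)
      then have "card {F. F \<subseteq> {..<m} - Y \<and> card F = (K - y) div 2} = (m - y) choose ((K - y) div 2)"
        using n_subsets[of "{..<m} - Y"] by simp
      then show "card (Pow Y \<times> {F. F \<subseteq> {..<m} - Y \<and> card F = (K - y) div 2})
          = 2 ^ y * ((m - y) choose ((K - y) div 2))"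
        using Y fY by (simp add: card_cartesian_product card_Pow)
  qed
  also have "\<dots> = (m choose y) * 2 ^ y * ((m - y) choose ((K - y) div 2))"
    using n_subsets[of "{..<m}" y] by simp
  finally show ?thesis .
qed

lemma card_patterns_full_le:
  assumes "2 * r \<le> K" "K \<le> 2 * m"
  shows "card {S \<in> patterns m K. r \<le> card (full_pairs m S)}
     \<le> (m choose r) * ((2 * m - 2 * r) choose (K - 2 * r))"
proof -
  define T where "T R = {S \<in> patterns m K. R \<times> UNIV \<subseteq> S}" for R :: "nat set"
  let ?I = "{R. R \<subseteq> {..<m} \<and> card R = r}"
  have fin: "finite ?I" by (rule finite_subset[of _ "Pow {..<m}"]) auto
  have "{S \<in> patterns m K. r \<le> card (full_pairs m S)} \<subseteq> (\<Union>R\<in>?I. T R)"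
  proof safe
    fix S assume S: "S \<in> patterns m K" and r: "r \<le> card (full_pairs m S)"
    obtain R where R: "R \<subseteq> full_pairs m S" "card R = r"
      using r by (meson obtain_subset_with_card_n)
    have "(i, b) \<in> S" if "i \<in> R" for i b
      using that R by (cases b) (auto simp: full_pairs_def)
    then show "S \<in> (\<Union>R\<in>?I. T R)"
      using R S by (auto simp: T_def full_pairs_def)
  qed
  then have "card {S \<in> patterns m K. r \<le> card (full_pairs m S)} \<le> card (\<Union>R\<in>?I. T R)"
    by (intro card_mono) (use fin in \<open>auto simp: T_def\<close>)
  also have "\<dots> \<le> (\<Sum>R\<in>?I. card (T R))" by (rule card_UN_le[OF fin])
  also have "\<dots> \<le> (\<Sum>R\<in>?I. (2 * m - 2 * r) choose (K - 2 * r))"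
  proof (rule sum_mono)
    fix R assume R: "R \<in> ?I"
    then have "R \<subseteq> {..<m}" by simp
    then have fR: "finite R" by (rule finite_subset) simp
    let ?R = "R \<times> (UNIV :: bool set)"
    have cR: "card ?R = 2 * r" using R by (simp add: card_cartesian_product)
    have sub: "?R \<subseteq> positions m" using R by (auto simp: positions_def)
    have c: "card (positions m - ?R) = 2 * m - 2 * r"
      using sub cR fR by (simp add: card_Diff_subset)
    have "card (T R) \<le> card {S. S \<subseteq> positions m - ?R \<and> card S = K - 2 * r}"
    proof (rule card_inj_on_le[of "\<lambda>S. S - ?R"])
      show "inj_on (\<lambda>S. S - ?R) (T R)" by (auto simp: inj_on_def T_def)
      show "(\<lambda>S. S - ?R) ` T R \<subseteq> {S. S \<subseteq> positions m - ?R \<and> card S = K - 2 * r}"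
        using cR fR by (auto simp: T_def patterns_def card_Diff_subset)
      show "finite {S. S \<subseteq> positions m - ?R \<and> card S = K - 2 * r}"
        by (rule finite_subset[of _ "Pow (positions m)"]) auto
    qed
    also have "\<dots> = (2 * m - 2 * r) choose (K - 2 * r)"
      using n_subsets[of "positions m - ?R" "K - 2 * r"] c by simp
    finally show "card (T R) \<le> (2 * m - 2 * r) choose (K - 2 * r)" .
  qed
  also have "\<dots> = (m choose r) * ((2 * m - 2 * r) choose (K - 2 * r))"
    using n_subsets[of "{..<m}" r] by simp
  finally show ?thesis .
qed

text \<open>
  The ratio of the two sides is a product of factors \<open>(K - t) / (N - t)\<close> with \<open>t < j\<close>, each at most
  \<open>K / N\<close>.
\<close>

lemma binomial_shift_le:
  assumes "j \<le> K" "K \<le> N" "N > 0"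
  shows "real ((N - j) choose (K - j)) \<le> (real K / real N) ^ j * real (N choose K)"
  using assms
proof (induction j)
  case (Suc j)
  have "(K - j) * ((N - j) choose (K - j)) = (N - j) * ((N - Suc j) choose (K - Suc j))"
    using binomial_absorption[of "K - Suc j" "N - j"] Suc.prems
    by (simp add: Suc_diff_Suc)
  then have "real (K - j) * real ((N - j) choose (K - j)) = real (N - j) * real ((N - Suc j) choose (K - Suc j))"
    by (metis of_nat_mult)
  then have "real ((N - Suc j) choose (K - Suc j)) = real (K - j) / real (N - j) * real ((N - j) choose (K - j))"
    using Suc.prems by (simp add: field_simps)
  also have "real (K - j) / real (N - j) \<le> real K / real N"
  proof -
    have "real j * real K \<le> real j * real N" using Suc.prems by (intro mult_left_mono) auto
    then show ?thesis using Suc.prems by (simp add: field_simps of_nat_diff)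
  qed
  then have "real (K - j) / real (N - j) * real ((N - j) choose (K - j))
      \<le> real K / real N * ((real K / real N) ^ j * real (N choose K))"
    using Suc by (intro mult_mono) auto
  finally show ?case by simp
qed auto

text \<open>One term of the binomial expansion of \<open>(a + b)^(a + b)\<close> is at most the sum.\<close>

lemma binomial_le_entropy:
  "real ((a + b) choose a) * real a ^ a * real b ^ b \<le> real (a + b) ^ (a + b)"
proof -
  have "(a + b choose a) * a ^ a * b ^ (a + b - a) \<le> (\<Sum>k\<le>a + b. (a + b choose k) * a ^ k * b ^ (a + b - k))"
    by (rule member_le_sum) auto
  also have "\<dots> = (a + b) ^ (a + b)" by (simp add: binomial)
  finally have "real ((a + b choose a) * a ^ a * b ^ b) \<le> real ((a + b) ^ (a + b))"
    by (simp only: of_nat_le_iff) simp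
  then show ?thesis by simp
qed

lemma unimodal_max:
  fixes t :: "nat \<Rightarrow> real"
  assumes "\<And>j. j < K \<Longrightarrow> t j \<le> t (Suc j)" "\<And>j. K \<le> j \<Longrightarrow> t (Suc j) \<le> t j"
  shows "t j \<le> t K"
proof (cases "j \<le> K")
  case True
  then show ?thesis
  proof (induction rule: inc_induct)
    case (step n)
    then show ?case using assms(1)[of n] by linarith
  qed simp
next
  case False
  then have "K \<le> j" by simp
  then show ?thesis
  proof (induction rule: dec_induct)
    case (step n)
    then show ?case using assms(2)[of n] by linarith
  qed simp
qed

text \<open>
  Conversely, that term is the largest of the \<open>a + b + 1\<close> terms of the expansion, because \<open>a\<close> is
  the mode of the binomial distribution with mean \<open>a\<close>.
\<close>

lemma entropy_le_binomial:
  "real (a + b) ^ (a + b) \<le> real (a + b + 1) * real ((a + b) choose a) * real a ^ a * real b ^ b"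
proof -
  define N where "N = a + b"
  define t where "t j = real (N choose j) * real a ^ j * real b ^ (N - j)" for j
  have step: "real (Suc j) * real (N choose Suc j) = real (N - j) * real (N choose j)" for j
    using binomial_absorb_comp[of N j] binomial_absorption[of j N]
    by (metis of_nat_mult times_binomial_minus1_eq zero_less_Suc diff_Suc_1)
  have up: "t j \<le> t (Suc j)" if "j < a" for j
  proof -
    have NS: "N - j = Suc (N - Suc j)" using that by (simp add: N_def)
    have "(j + 1) * b \<le> a * (N - j)"
    proof -
      have "(j + 1) * b \<le> a * b" using that by (intro mult_right_mono) auto
      also have "\<dots> \<le> a * (N - j)" using that by (intro mult_left_mono) (auto simp: N_def)
      finally show ?thesis .
    qed
    then have le: "real (Suc j) * real b \<le> real a * real (N - j)"
      by (metis Suc_eq_plus1 of_nat_le_iff of_nat_mult)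
    have "real (Suc j) * t j = (real (Suc j) * real b) * (real (N choose j) * real a ^ j * real b ^ (N - Suc j))"
      unfolding t_def NS by simp
    also have "\<dots> \<le> (real a * real (N - j)) * (real (N choose j) * real a ^ j * real b ^ (N - Suc j))"
      using le by (intro mult_right_mono) auto
    also have "\<dots> = (real (N - j) * real (N choose j)) * (real a ^ Suc j * real b ^ (N - Suc j))"
      by simp
    also have "\<dots> = real (Suc j) * t (Suc j)" unfolding step[symmetric] t_def by simp
    finally show ?thesis by (subst (asm) mult_le_cancel_left_pos) auto
  qed
  have down: "t (Suc j) \<le> t j" if "a \<le> j" for j
  proof (cases "j < N")
    case True
    then have NS: "N - j = Suc (N - Suc j)" by simp
    have "a * (N - j) \<le> (j + 1) * b"
    proof -
      have "a * (N - j) \<le> a * b" using that by (intro mult_left_mono) (auto simp: N_def)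
      also have "\<dots> \<le> (j + 1) * b" using that by (intro mult_right_mono) auto
      finally show ?thesis .
    qed
    then have le: "real a * real (N - j) \<le> real (Suc j) * real b"
      by (metis Suc_eq_plus1 of_nat_le_iff of_nat_mult)
    have "real (Suc j) * t (Suc j) = (real (N - j) * real (N choose j)) * (real a ^ Suc j * real b ^ (N - Suc j))"
      unfolding step[symmetric] t_def by simp
    also have "\<dots> = (real a * real (N - j)) * (real (N choose j) * real a ^ j * real b ^ (N - Suc j))"
      by simp
    also have "\<dots> \<le> (real (Suc j) * real b) * (real (N choose j) * real a ^ j * real b ^ (N - Suc j))"
      using le by (intro mult_right_mono) auto
    also have "\<dots> = real (Suc j) * t j" unfolding t_def NS by simp
    finally show ?thesis by (subst (asm) mult_le_cancel_left_pos) auto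
  next
    case False
    then have "real (N choose Suc j) = 0" by simp
    then have "t (Suc j) = 0" by (simp only: t_def mult_zero_left)
    moreover have "0 \<le> t j" unfolding t_def by simp
    ultimately show ?thesis by linarith
  qed
  have max: "t j \<le> t a" for j
    by (rule unimodal_max[of a t j]) (erule up, erule down)
  have "real N ^ N = (\<Sum>j\<le>N. t j)"
    unfolding t_def N_def using binomial_ring[of "real a" "real b" "a + b"] by simp
  also have "\<dots> \<le> (\<Sum>j\<le>N. t a)" by (intro sum_mono max)
  also have "\<dots> = real (N + 1) * t a" by simp
  finally show ?thesis by (simp add: t_def N_def mult.assoc)
qed

lemma self_power_exp_le: "real k ^ k \<le> exp (real k) * fact k"
proof -
  have "real k ^ k /\<^sub>R fact k \<le> exp (real k)"
    using sum_le_suminf[OF summable_exp_generic[of "real k"], of "{k}"] by (simp add: exp_def)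
  then show ?thesis by (simp add: field_simps)
qed

lemma binomial_le_exp:
  assumes "k > 0"
  shows "real (n choose k) \<le> (exp 1 * real n / real k) ^ k"
proof -
  have "real (n choose k) * fact k \<le> real n ^ k"
    using binomial_fact_pow[of n k] by (metis of_nat_fact of_nat_le_iff of_nat_mult of_nat_power)
  then have "real (n choose k) * real k ^ k \<le> real (n choose k) * (exp (real k) * fact k)"
    using self_power_exp_le[of k] by (intro mult_left_mono) auto
  also have "\<dots> = exp (real k) * (real (n choose k) * fact k)" by simp
  also have "\<dots> \<le> exp (real k) * real n ^ k"
    using \<open>real (n choose k) * fact k \<le> real n ^ k\<close> by (intro mult_left_mono) auto
  also have "exp (real k) = exp 1 ^ k" by (metis exp_of_nat_mult mult.right_neutral)
  finally show ?thesis using assms by (simp add: power_divide power_mult_distrib field_simps)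
qed

section \<open>Words and their patterns\<close>

definition fibre :: "nat \<Rightarrow> (nat \<times> bool \<Rightarrow> nat) \<Rightarrow> nat \<Rightarrow> (nat \<times> bool) set" where
  "fibre m w v = {p \<in> positions m. w p = v}"

definition words :: "nat \<Rightarrow> nat \<Rightarrow> nat \<Rightarrow> (nat \<times> bool \<Rightarrow> nat) set" where
  "words n d m = {w \<in> positions m \<rightarrow>\<^sub>E {..<n}. \<forall>v<n. card (fibre m w v) = d}"

lemma finite_fibre [simp]: "finite (fibre m w v)"
  by (simp add: fibre_def)

lemma finite_words [simp]: "finite (words n d m)"
  by (rule finite_subset[of _ "positions m \<rightarrow>\<^sub>E {..<n}"]) (auto simp: words_def intro!: finite_PiE)

lemma words_less: "w \<in> words n d m \<Longrightarrow> p \<in> positions m \<Longrightarrow> w p < n"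
  using PiE_mem[of w "positions m" "\<lambda>_. {..<n}" p] by (simp add: words_def)

lemma card_fibre: "w \<in> words n d m \<Longrightarrow> v < n \<Longrightarrow> card (fibre m w v) = d"
  by (auto simp: words_def)

lemma card_fibre_le: "w \<in> words n d m \<Longrightarrow> card (fibre m w v) \<le> d"
proof (cases "v < n")
  case False
  assume "w \<in> words n d m"
  then have "fibre m w v = {}" using False by (auto simp: fibre_def dest: words_less)
  then show ?thesis by simp
qed (auto simp: card_fibre)

lemma words_comp_permutes:
  assumes "w \<in> words n d m" "\<pi> permutes positions m"
  shows "w \<circ> \<pi> \<in> words n d m"
proof -
  have "fibre m w v = \<pi> ` fibre m (w \<circ> \<pi>) v" for v
  proof -
    have "p \<in> \<pi> ` fibre m (w \<circ> \<pi>) v" if "p \<in> fibre m w v" for p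
    proof -
      have "inv \<pi> p \<in> fibre m (w \<circ> \<pi>) v" "p = \<pi> (inv \<pi> p)"
        using that permutes_in_image[OF permutes_inv[OF assms(2)], of p] permutes_inverses(1)[OF assms(2)]
        by (auto simp: fibre_def)
      then show ?thesis by blast
    qed
    then show ?thesis
      using permutes_in_image[OF assms(2)] by (auto simp: fibre_def)
  qed
  then have "card (fibre m (w \<circ> \<pi>) v) = card (fibre m w v)" for v
    using permutes_inj[OF assms(2)] by (metis card_image inj_on_subset subset_UNIV)
  moreover have "w \<circ> \<pi> \<in> positions m \<rightarrow>\<^sub>E {..<n}"
  proof (rule PiE_I)
    fix p assume "p \<in> positions m"
    then have "\<pi> p \<in> positions m" using permutes_in_image[OF assms(2)] by blast
    then show "(w \<circ> \<pi>) p \<in> {..<n}" using words_less[OF assms(1)] by simp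
  next
    fix p assume "p \<notin> positions m"
    then show "(w \<circ> \<pi>) p = undefined"
      using permutes_not_in[OF assms(2)] assms(1) by (auto simp: words_def dest: PiE_arb)
  qed
  ultimately show ?thesis using assms(1) by (auto simp: words_def)
qed

lemma card_words_comp_permutes:
  assumes "\<pi> permutes positions m"
  shows "card {w \<in> words n d m. P (w \<circ> \<pi>)} = card {w \<in> words n d m. P w}"
proof -
  have "{w \<in> words n d m. P w} = (\<lambda>w. w \<circ> \<pi>) ` {w \<in> words n d m. P (w \<circ> \<pi>)}"
  proof (intro set_eqI iffI)
    fix w assume w: "w \<in> {w \<in> words n d m. P w}"
    have "w = w \<circ> inv \<pi> \<circ> \<pi>" using permutes_inv_o(2)[OF assms] by (simp add: comp_assoc)
    moreover have "w \<circ> inv \<pi> \<in> words n d m"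
      using w words_comp_permutes[OF _ permutes_inv[OF assms]] by auto
    ultimately show "w \<in> (\<lambda>w. w \<circ> \<pi>) ` {w \<in> words n d m. P (w \<circ> \<pi>)}"
      using w by (intro image_eqI[of _ _ "w \<circ> inv \<pi>"]) auto
  qed (auto intro: words_comp_permutes[OF _ assms])
  moreover have "inj_on (\<lambda>w. w \<circ> \<pi>) {w \<in> words n d m. P (w \<circ> \<pi>)}"
  proof (rule inj_onI)
    fix w w' :: "nat \<times> bool \<Rightarrow> nat" assume "w \<circ> \<pi> = w' \<circ> \<pi>"
    then have "w \<circ> (\<pi> \<circ> inv \<pi>) = w' \<circ> (\<pi> \<circ> inv \<pi>)" by (simp add: comp_assoc[symmetric])
    then show "w = w'" using permutes_inv_o(1)[OF assms] by simp
  qed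
  ultimately show ?thesis by (simp add: card_image)
qed

lemma words_nonempty:
  assumes "d * n = 2 * m"
  shows "words n d m \<noteq> {}"
proof -
  have "card (positions m) = card ({..<n} \<times> {..<d})"
    using assms by (simp add: card_cartesian_product mult.commute)
  then obtain h where h: "bij_betw h (positions m) ({..<n} \<times> {..<d})"
    using finite_same_card_bij[of "positions m" "{..<n} \<times> {..<d}"] by auto
  define w where "w = restrict (fst \<circ> h) (positions m)"
  have "card (fibre m w v) = d" if "v < n" for v
  proof -
    have "h ` fibre m w v = {v} \<times> {..<d}"
    proof (intro set_eqI iffI)
      fix x assume "x \<in> h ` fibre m w v"
      then show "x \<in> {v} \<times> {..<d}"
        using bij_betwE[OF h] by (force simp: fibre_def w_def)
    next
      fix x assume x: "x \<in> {v} \<times> {..<d}"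
      then have "x \<in> h ` positions m" using h that by (auto simp: bij_betw_def)
      then obtain p where "p \<in> positions m" "x = h p" by blast
      then have "p \<in> fibre m w v" "x = h p" using x by (auto simp: fibre_def w_def)
      then show "x \<in> h ` fibre m w v" by blast
    qed
    moreover have "inj_on h (fibre m w v)"
      using h by (auto simp: bij_betw_def fibre_def intro: inj_on_subset)
    ultimately have "card (fibre m w v) = card ({v} \<times> {..<d})" by (metis card_image)
    then show ?thesis by (simp add: card_cartesian_product)
  qed
  moreover have "w \<in> positions m \<rightarrow>\<^sub>E {..<n}"
    using bij_betwE[OF h] by (force simp: w_def)
  ultimately have "w \<in> words n d m" by (auto simp: words_def)
  then show ?thesis by auto
qed

definition word_pattern :: "nat \<Rightarrow> (nat \<times> bool \<Rightarrow> nat) \<Rightarrow> nat set \<Rightarrow> (nat \<times> bool) set" where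
  "word_pattern m w U = {p \<in> positions m. w p \<in> U}"

lemma word_pattern_in_patterns:
  assumes "w \<in> words n d m" "U \<subseteq> {..<n}"
  shows "word_pattern m w U \<in> patterns m (d * card U)"
proof -
  have fU: "finite U" using assms(2) by (rule finite_subset) simp
  have "word_pattern m w U = (\<Union>v\<in>U. fibre m w v)" by (auto simp: word_pattern_def fibre_def)
  also have "card \<dots> = (\<Sum>v\<in>U. card (fibre m w v))"
    by (rule card_UN_disjoint[OF fU]) (auto simp: fibre_def)
  also have "\<dots> = (\<Sum>v\<in>U. d)" using assms by (intro sum.cong refl card_fibre) auto
  finally show ?thesis by (auto simp: patterns_def word_pattern_def mult.commute)
qed

lemma ex_permutes_image:
  assumes "finite P" "S \<subseteq> P" "T \<subseteq> P" "card S = card T"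
  obtains \<pi> where "\<pi> permutes P" "\<And>p. p \<in> P \<Longrightarrow> \<pi> p \<in> T \<longleftrightarrow> p \<in> S"
proof -
  have fin: "finite S" "finite T" using assms finite_subset by blast+
  obtain f where f: "bij_betw f S T" using finite_same_card_bij[OF fin assms(4)] by auto
  have "card (P - S) = card (P - T)" using assms fin by (simp add: card_Diff_subset)
  then obtain g where g: "bij_betw g (P - S) (P - T)"
    using finite_same_card_bij[of "P - S" "P - T"] assms by auto
  define \<pi> where "\<pi> p = (if p \<in> S then f p else if p \<in> P then g p else p)" for p
  have "bij_betw \<pi> S T" using f by (subst bij_betw_cong[of S \<pi> f]) (auto simp: \<pi>_def)
  moreover have "bij_betw \<pi> (P - S) (P - T)"
    using g by (subst bij_betw_cong[of "P - S" \<pi> g]) (auto simp: \<pi>_def)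
  ultimately have "bij_betw \<pi> (S \<union> (P - S)) (T \<union> (P - T))"
    by (rule bij_betw_combine) auto
  then have "bij_betw \<pi> P P" using assms by (simp add: Un_absorb1)
  then have "\<pi> permutes P" using assms by (intro bij_imp_permutes) (auto simp: \<pi>_def)
  moreover have "\<pi> p \<in> T \<longleftrightarrow> p \<in> S" if "p \<in> P" for p
    using that bij_betwE[OF f] bij_betwE[OF g] by (auto simp: \<pi>_def)
  ultimately show ?thesis using that by blast
qed

lemma card_words_pattern_eq:
  assumes "S \<in> patterns m K" "T \<in> patterns m K"
  shows "card {w \<in> words n d m. word_pattern m w U = S} = card {w \<in> words n d m. word_pattern m w U = T}"
proof -
  have ST: "S \<subseteq> positions m" "T \<subseteq> positions m" "card S = card T"
    using assms by (auto simp: patterns_def)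
  obtain \<pi> where \<pi>: "\<pi> permutes positions m" "\<And>p. p \<in> positions m \<Longrightarrow> \<pi> p \<in> T \<longleftrightarrow> p \<in> S"
    using ex_permutes_image[OF finite_positions ST] by metis
  have "word_pattern m (w \<circ> \<pi>) U = S \<longleftrightarrow> word_pattern m w U = T" for w
  proof -
    have *: "p \<in> word_pattern m (w \<circ> \<pi>) U \<longleftrightarrow> \<pi> p \<in> word_pattern m w U" if "p \<in> positions m" for p
      using that permutes_in_image[OF \<pi>(1)] by (simp add: word_pattern_def)
    have "word_pattern m (w \<circ> \<pi>) U = S
        \<longleftrightarrow> (\<forall>p\<in>positions m. p \<in> word_pattern m (w \<circ> \<pi>) U \<longleftrightarrow> p \<in> S)"
      using ST by (auto simp: word_pattern_def)
    also have "\<dots> \<longleftrightarrow> (\<forall>p\<in>positions m. \<pi> p \<in> word_pattern m w U \<longleftrightarrow> \<pi> p \<in> T)"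
      using * \<pi>(2) by simp
    also have "\<dots> \<longleftrightarrow> (\<forall>q\<in>\<pi> ` positions m. q \<in> word_pattern m w U \<longleftrightarrow> q \<in> T)" by simp
    also have "\<dots> \<longleftrightarrow> word_pattern m w U = T"
      unfolding permutes_image[OF \<pi>(1)] using ST by (auto simp: word_pattern_def)
    finally show ?thesis .
  qed
  then show ?thesis
    using card_words_comp_permutes[OF \<pi>(1), of n d "\<lambda>w. word_pattern m w U = S"] by simp
qed

lemma card_preimage_sum:
  assumes "finite A" "finite F"
  shows "card {w \<in> A. f w \<in> F} = (\<Sum>S\<in>F. card {w \<in> A. f w = S})"
proof -
  have "{w \<in> A. f w \<in> F} = (\<Union>S\<in>F. {w \<in> A. f w = S})" by auto
  moreover have "card (\<Union>S\<in>F. {w \<in> A. f w = S}) = (\<Sum>S\<in>F. card {w \<in> A. f w = S})"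
    using assms by (intro card_UN_disjoint) auto
  ultimately show ?thesis by simp
qed

text \<open>
  The pattern of a random word is uniform among the sets of the right size: permutations of the
  positions act transitively on these sets and preserve the set of words.
\<close>

lemma card_words_pattern_in:
  assumes "U \<subseteq> {..<n}" "F \<subseteq> patterns m (d * card U)"
  shows "card {w \<in> words n d m. word_pattern m w U \<in> F} * ((2 * m) choose (d * card U))
           = card F * card (words n d m)"
proof -
  let ?P = "patterns m (d * card U)"
  let ?c = "\<lambda>S. card {w \<in> words n d m. word_pattern m w U = S}"
  have fF: "finite F" using assms(2) by (rule finite_subset) simp
  have "words n d m = {w \<in> words n d m. word_pattern m w U \<in> ?P}"
    using word_pattern_in_patterns assms(1) by auto
  then have N: "card (words n d m) = (\<Sum>S\<in>?P. ?c S)"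
    using card_preimage_sum[of "words n d m" ?P "\<lambda>w. word_pattern m w U"] by simp
  have "card {w \<in> words n d m. word_pattern m w U \<in> F} * card ?P = (\<Sum>S\<in>F. \<Sum>T\<in>?P. ?c S)"
    by (simp add: card_preimage_sum fF sum_distrib_left mult.commute)
  also have "\<dots> = (\<Sum>S\<in>F. \<Sum>T\<in>?P. ?c T)"
    using assms(2) by (intro sum.cong refl card_words_pattern_eq) auto
  also have "\<dots> = card F * card (words n d m)" by (simp add: N)
  finally show ?thesis by (simp add: card_patterns)
qed

definition pair_edge :: "(nat \<times> bool \<Rightarrow> nat) \<Rightarrow> nat \<Rightarrow> nat set" where
  "pair_edge w i = {w (i, False), w (i, True)}"

text \<open>
  The pairs that prevent the word from describing a simple graph: loops and members of a multiple
  edge.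
\<close>

definition bad_pairs :: "nat \<Rightarrow> (nat \<times> bool \<Rightarrow> nat) \<Rightarrow> nat set" where
  "bad_pairs m w = {i \<in> {..<m}. w (i, False) = w (i, True) \<or>
     (\<exists>k<m. k \<noteq> i \<and> pair_edge w k = pair_edge w i)}"

lemma finite_bad_pairs [simp]: "finite (bad_pairs m w)"
  by (simp add: bad_pairs_def)

abbreviation swap_at :: "(nat \<times> bool \<Rightarrow> nat) \<Rightarrow> nat \<times> bool \<Rightarrow> nat \<times> bool \<Rightarrow> nat \<times> bool \<Rightarrow> nat" where
  "swap_at w q r \<equiv> w \<circ> Transposition.transpose q r"

lemma swap_at_words: "w \<in> words n d m \<Longrightarrow> q \<in> positions m \<Longrightarrow> r \<in> positions m \<Longrightarrow> swap_at w q r \<in> words n d m"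
  by (intro words_comp_permutes permutes_swap_id)

lemma swap_at_swap_at [simp]: "swap_at (swap_at w q r) q r = w"
  by (simp add: comp_assoc)

text \<open>
  Exchanging the letter at \<open>q\<close> with that at \<open>r\<close> turns the coincidence of \<open>p\<close> and \<open>q\<close> into one of
  \<open>p\<close> and \<open>r\<close>. The exchanged word and \<open>r\<close> determine the original word, and a given word has at
  most \<open>d\<close> positions \<open>r\<close> with the letter of \<open>p\<close>.
\<close>

lemma card_coincidence_le:
  assumes "A \<subseteq> words n d m" "p \<in> positions m" "p \<noteq> q" "R \<subseteq> positions m - {p}"
    and closed: "\<And>w r. w \<in> A \<Longrightarrow> r \<in> R \<Longrightarrow> swap_at w q r \<in> A"
  shows "card {w \<in> A. w p = w q} * card R \<le> d * card A"
proof -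
  have fA: "finite A" using assms(1) by (rule finite_subset) simp
  define f where "f = (\<lambda>(w, r). (swap_at w q r, r))"
  have "card ({w \<in> A. w p = w q} \<times> R) \<le> card (SIGMA w:A. fibre m w (w p))"
  proof (rule card_inj_on_le[of f])
    show "inj_on f ({w \<in> A. w p = w q} \<times> R)"
    proof (rule inj_onI, clarify)
      fix w r w' r' assume "f (w, r) = f (w', r')"
      then have "r = r'" "swap_at w q r = swap_at w' q r" by (auto simp: f_def)
      then show "w = w' \<and> r = r'" by (metis swap_at_swap_at)
    qed
    show "f ` ({w \<in> A. w p = w q} \<times> R) \<subseteq> (SIGMA w:A. fibre m w (w p))"
      using assms closed by (auto simp: f_def fibre_def Transposition.transpose_def)
    show "finite (SIGMA w:A. fibre m w (w p))" using fA by auto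
  qed
  also have "\<dots> = (\<Sum>w\<in>A. card (fibre m w (w p)))" using fA by (intro card_SigmaI) auto
  also have "\<dots> \<le> (\<Sum>w\<in>A. d)" using assms(1) by (intro sum_mono card_fibre_le) auto
  finally show ?thesis by (simp add: card_cartesian_product mult.commute)
qed

lemma card_coincidence1:
  assumes "p \<in> positions m" "q \<in> positions m" "p \<noteq> q"
  shows "real (card {w \<in> words n d m. w p = w q}) \<le> real d / real m * real (card (words n d m))"
proof -
  have m: "m > 0" using assms by (auto simp: positions_def)
  have "card {w \<in> words n d m. w p = w q} * card (positions m - {p}) \<le> d * card (words n d m)"
    using assms by (intro card_coincidence_le) (auto intro: swap_at_words)
  moreover have "card {w \<in> words n d m. w p = w q} * m
      \<le> card {w \<in> words n d m. w p = w q} * card (positions m - {p})"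
    using m assms by (intro mult_left_mono) auto
  ultimately have "card {w \<in> words n d m. w p = w q} * m \<le> d * card (words n d m)"
    by linarith
  then have "real (card {w \<in> words n d m. w p = w q}) * real m \<le> real d * real (card (words n d m))"
    by (simp only: of_nat_le_iff flip: of_nat_mult)
  then show ?thesis using m by (simp add: field_simps)
qed

lemma card_coincidence2:
  assumes "p \<in> positions m" "q \<in> positions m" "p' \<in> positions m" "q' \<in> positions m"
    "p \<noteq> q" "p' \<noteq> q'" "p' \<notin> {p, q}" "q' \<notin> {p, q}" "m \<ge> 3"
  shows "real (card {w \<in> words n d m. w p = w q \<and> w p' = w q'})
          \<le> (real d / real m) ^ 2 * real (card (words n d m))"
proof -
  let ?A = "{w \<in> words n d m. w p = w q}"
  let ?B = "{w \<in> words n d m. w p = w q \<and> w p' = w q'}"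
  have B: "?B = {w \<in> ?A. w p' = w q'}" by auto
  have "card {w \<in> ?A. w p' = w q'} * card (positions m - {p, q, p'}) \<le> d * card ?A"
  proof (rule card_coincidence_le)
    fix w r assume "w \<in> ?A" "r \<in> positions m - {p, q, p'}"
    then show "swap_at w q' r \<in> ?A"
      using assms by (auto intro: swap_at_words simp: Transposition.transpose_def)
  qed (use assms in auto)
  moreover have "m \<le> card (positions m - {p, q, p'})"
  proof -
    have "card {p, q, p'} \<le> 3" by (simp add: card_insert_if)
    then have "card (positions m) - 3 \<le> card (positions m - {p, q, p'})"
      using diff_card_le_card_Diff[of "{p, q, p'}" "positions m"] by simp
    then show ?thesis using assms by simp
  qed
  then have "card {w \<in> ?A. w p' = w q'} * m \<le> card {w \<in> ?A. w p' = w q'} * card (positions m - {p, q, p'})"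
    by (rule mult_left_mono) simp
  ultimately have "card ?B * m \<le> d * card ?A" unfolding B by linarith
  then have "real (card ?B) * real m \<le> real d * real (card ?A)"
    by (simp only: of_nat_le_iff flip: of_nat_mult)
  then have "real (card ?B) \<le> real d / real m * real (card ?A)"
    using assms(9) by (simp add: field_simps)
  also have "\<dots> \<le> real d / real m * (real d / real m * real (card (words n d m)))"
    using assms by (intro mult_left_mono card_coincidence1) auto
  finally show ?thesis by (simp add: power2_eq_square)
qed

text \<open>
  A pair is a loop with probability at most \<open>d / m\<close>, and two pairs are parallel, in one of two
  orientations, with probability at most \<open>2 (d / m)^2\<close>.
\<close>

lemma sum_card_bad_pairs_le:
  assumes "m \<ge> 3"
  shows "real (\<Sum>w\<in>words n d m. card (bad_pairs m w)) \<le> real (d + 2 * d ^ 2) * real (card (words n d m))"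
proof -
  let ?W = "words n d m" and ?N = "real (card (words n d m))"
  have each: "real (card {w \<in> ?W. i \<in> bad_pairs m w}) \<le> real d / real m * ?N + real m * (2 * ((real d / real m)^2 * ?N))"
    if i: "i < m" for i
  proof -
    define L where "L = {w \<in> ?W. w (i, False) = w (i, True)}"
    define X where "X k = {w \<in> ?W. w (i, False) = w (k, False) \<and> w (i, True) = w (k, True)}" for k
    define Y where "Y k = {w \<in> ?W. w (i, False) = w (k, True) \<and> w (i, True) = w (k, False)}" for k
    have fin: "finite L" "finite (X k)" "finite (Y k)" for k by (auto simp: L_def X_def Y_def)
    have sub: "{w \<in> ?W. i \<in> bad_pairs m w} \<subseteq> L \<union> (\<Union>k\<in>{..<m} - {i}. X k \<union> Y k)"
      by (auto simp: bad_pairs_def pair_edge_def doubleton_eq_iff L_def X_def Y_def)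
    have "card {w \<in> ?W. i \<in> bad_pairs m w} \<le> card (L \<union> (\<Union>k\<in>{..<m} - {i}. X k \<union> Y k))"
      using fin by (intro card_mono sub) auto
    also have "\<dots> \<le> card L + card (\<Union>k\<in>{..<m} - {i}. X k \<union> Y k)" by (rule card_Un_le)
    also have "\<dots> \<le> card L + (\<Sum>k\<in>{..<m} - {i}. card (X k \<union> Y k))"
      by (intro add_left_mono card_UN_le) auto
    also have "\<dots> \<le> card L + (\<Sum>k\<in>{..<m} - {i}. card (X k) + card (Y k))"
      by (intro add_left_mono sum_mono card_Un_le)
    finally have "real (card {w \<in> ?W. i \<in> bad_pairs m w})
        \<le> real (card L) + (\<Sum>k\<in>{..<m} - {i}. real (card (X k)) + real (card (Y k)))"
      by (simp only: of_nat_le_iff flip: of_nat_add of_nat_sum)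
    also have "\<dots> \<le> real d / real m * ?N + (\<Sum>k\<in>{..<m} - {i}. 2 * ((real d / real m)^2 * ?N))"
    proof (intro add_mono sum_mono)
      show "real (card L) \<le> real d / real m * ?N"
        unfolding L_def using i by (intro card_coincidence1) (auto simp: positions_def)
      fix k assume k: "k \<in> {..<m} - {i}"
      have "real (card (X k)) \<le> (real d / real m)^2 * ?N"
        unfolding X_def using i k assms by (intro card_coincidence2) (auto simp: positions_def)
      moreover have "real (card (Y k)) \<le> (real d / real m)^2 * ?N"
        unfolding Y_def using i k assms by (intro card_coincidence2) (auto simp: positions_def)
      ultimately show "real (card (X k)) + real (card (Y k)) \<le> 2 * ((real d / real m)^2 * ?N)" by simp
    qed
    also have "(\<Sum>k\<in>{..<m} - {i}. 2 * ((real d / real m)^2 * ?N)) \<le> real m * (2 * ((real d / real m)^2 * ?N))"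
    proof -
      have "(\<Sum>k\<in>{..<m} - {i}. 2 * ((real d / real m)^2 * ?N)) = real (m - 1) * (2 * ((real d / real m)^2 * ?N))"
        using i by simp
      also have "\<dots> \<le> real m * (2 * ((real d / real m)^2 * ?N))" by (intro mult_right_mono) auto
      finally show ?thesis .
    qed
    finally show ?thesis by simp
  qed
  have "(\<Sum>w\<in>?W. card (bad_pairs m w)) = (\<Sum>w\<in>?W. \<Sum>i<m. if i \<in> bad_pairs m w then 1 else 0)"
  proof (rule sum.cong[OF refl])
    fix w
    have "bad_pairs m w = {i \<in> {..<m}. i \<in> bad_pairs m w}" by (auto simp: bad_pairs_def)
    then show "card (bad_pairs m w) = (\<Sum>i<m. if i \<in> bad_pairs m w then 1 else 0)"
      by (subst sum.inter_filter[symmetric]) auto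
  qed
  also have "\<dots> = (\<Sum>i<m. \<Sum>w\<in>?W. if i \<in> bad_pairs m w then 1 else 0)" by (rule sum.swap)
  also have "\<dots> = (\<Sum>i<m. card {w \<in> ?W. i \<in> bad_pairs m w})"
    by (intro sum.cong refl, subst sum.inter_filter[symmetric]) auto
  finally have "real (\<Sum>w\<in>?W. card (bad_pairs m w)) = (\<Sum>i<m. real (card {w \<in> ?W. i \<in> bad_pairs m w}))"
    by simp
  also have "\<dots> \<le> (\<Sum>i<m. real d / real m * ?N + real m * (2 * ((real d / real m)^2 * ?N)))"
    using each by (intro sum_mono) auto
  also have "\<dots> = real (d + 2 * d ^ 2) * ?N"
    using assms by (simp add: field_simps power2_eq_square)
  finally show ?thesis .
qed

text \<open>The Markov inequality; \<open>J\<close> is twice the bound on the mean.\<close>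

lemma half_words_few_bad_pairs:
  assumes "m \<ge> 3" "J = 2 * (d + 2 * d ^ 2)" "d > 0"
  shows "card (words n d m) \<le> 2 * card {w \<in> words n d m. card (bad_pairs m w) \<le> J}"
proof -
  let ?W = "words n d m"
  let ?H = "{w \<in> ?W. \<not> card (bad_pairs m w) \<le> J}"
  have "J * card ?H = (\<Sum>w\<in>?H. J)" by (simp only: sum_constant of_nat_id mult.commute)
  also have "\<dots> \<le> (\<Sum>w\<in>?H. card (bad_pairs m w))" by (intro sum_mono) auto
  also have "\<dots> \<le> (\<Sum>w\<in>?W. card (bad_pairs m w))" by (intro sum_mono2) auto
  finally have "J * card ?H \<le> (\<Sum>w\<in>?W. card (bad_pairs m w))" .
  then have "real (J * card ?H) \<le> real (d + 2 * d ^ 2) * real (card ?W)"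
    using sum_card_bad_pairs_le[OF assms(1), of n d] by linarith
  moreover have "2 * (real (d + 2 * d ^ 2) * real (card ?W)) = real (J * card ?W)"
    unfolding assms(2) by simp
  ultimately have "real (J * (2 * card ?H)) \<le> real (J * card ?W)"
    by (simp only: of_nat_mult of_nat_numeral)
  then have "J * (2 * card ?H) \<le> J * card ?W" by (simp only: of_nat_le_iff)
  then have "2 * card ?H \<le> card ?W" using assms by simp
  moreover have "card ?W = card {w \<in> ?W. card (bad_pairs m w) \<le> J} + card ?H"
    by (subst card_Un_disjoint[symmetric]) (auto intro: arg_cong[where f = card])
  ultimately show ?thesis by simp
qed

section \<open>A positive fraction of the words is simple\<close>

definition partner :: "nat \<times> bool \<Rightarrow> nat \<times> bool" where
  "partner p = (fst p, \<not> snd p)"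

definition neighbours :: "nat \<Rightarrow> (nat \<times> bool \<Rightarrow> nat) \<Rightarrow> nat \<Rightarrow> nat set" where
  "neighbours m w v = (\<lambda>p. w (partner p)) ` fibre m w v"

lemma neighbours_iff:
  "x \<in> neighbours m w v \<longleftrightarrow> (\<exists>k<m. (w (k, False) = v \<and> w (k, True) = x) \<or> (w (k, True) = v \<and> w (k, False) = x))"
proof
  assume "x \<in> neighbours m w v"
  then obtain k b where "k < m" "w (k, b) = v" "w (k, \<not> b) = x"
    by (auto simp: neighbours_def fibre_def partner_def positions_def)
  then show "\<exists>k<m. (w (k, False) = v \<and> w (k, True) = x) \<or> (w (k, True) = v \<and> w (k, False) = x)"
    by (cases b) auto
next
  assume "\<exists>k<m. (w (k, False) = v \<and> w (k, True) = x) \<or> (w (k, True) = v \<and> w (k, False) = x)"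
  then obtain k b where "k < m" "w (k, b) = v" "w (k, \<not> b) = x" by force
  then show "x \<in> neighbours m w v"
    unfolding neighbours_def by (intro image_eqI[of _ _ "(k, b)"]) (auto simp: fibre_def partner_def positions_def)
qed

lemma neighbours_if_pair_edge:
  "k < m \<Longrightarrow> pair_edge w k = {x, v} \<Longrightarrow> x \<in> neighbours m w v"
  unfolding neighbours_iff pair_edge_def doubleton_eq_iff by blast

lemma card_neighbours_le: "w \<in> words n d m \<Longrightarrow> card (neighbours m w v) \<le> d"
  unfolding neighbours_def by (meson card_fibre_le card_image_le finite_fibre le_trans)

lemma finite_neighbours [simp]: "finite (neighbours m w v)"
  by (simp add: neighbours_def)

text \<open>
  The pairs \<open>j\<close> for which exchanging the first letters of \<open>i\<close> and \<open>j\<close> repairs \<open>i\<close> and spoils nothing: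
  the two new edges are not loops, and neither is already present.
\<close>

definition switch_targets :: "nat \<Rightarrow> (nat \<times> bool \<Rightarrow> nat) \<Rightarrow> nat \<Rightarrow> nat set" where
  "switch_targets m w i = {j \<in> {..<m}. j \<noteq> i \<and> j \<notin> bad_pairs m w \<and>
     w (j, False) \<notin> neighbours m w (w (i, True)) \<union> {w (i, False), w (i, True)} \<and>
     w (j, True) \<notin> neighbours m w (w (i, False)) \<union> {w (i, False), w (i, True)}}"

text \<open>
  All pairs are admissible but \<open>i\<close> itself, the bad ones, and those meeting one of at most \<open>2 d + 2\<close>
  forbidden letters, each of which occurs \<open>d\<close> times.
\<close>

lemma card_switch_targets:
  assumes "w \<in> words n d m"
  shows "m \<le> card (switch_targets m w i) + (1 + card (bad_pairs m w) + (2 * d + 2) * d)"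
proof -
  define X where "X = neighbours m w (w (i, True)) \<union> neighbours m w (w (i, False)) \<union> {w (i, False), w (i, True)}"
  have finX: "finite X" by (simp add: X_def)
  have "card X \<le> card (neighbours m w (w (i, True)) \<union> neighbours m w (w (i, False))) + card {w (i, False), w (i, True)}"
    unfolding X_def by (rule card_Un_le)
  also have "\<dots> \<le> card (neighbours m w (w (i, True))) + card (neighbours m w (w (i, False))) + 2"
    by (intro add_mono card_Un_le) (auto simp: card_insert_if)
  also have "\<dots> \<le> 2 * d + 2"
    using card_neighbours_le[OF assms, of "w (i, True)"] card_neighbours_le[OF assms, of "w (i, False)"] by simp
  finally have cX: "card X \<le> 2 * d + 2" .
  let ?Y = "fst ` (\<Union>x\<in>X. fibre m w x)"
  have "card ?Y \<le> card (\<Union>x\<in>X. fibre m w x)" using finX by (intro card_image_le) auto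
  also have "\<dots> \<le> (\<Sum>x\<in>X. card (fibre m w x))" by (rule card_UN_le[OF finX])
  also have "\<dots> \<le> (\<Sum>x\<in>X. d)" by (intro sum_mono card_fibre_le[OF assms])
  also have "\<dots> \<le> (2 * d + 2) * d" using mult_right_mono[OF cX, of d] by simp
  finally have cY: "card ?Y \<le> (2 * d + 2) * d" .
  have Y: "j \<in> ?Y" if "j < m" "w (j, b) \<in> X" for j b
    using that by (intro image_eqI[of _ _ "(j, b)"]) (auto simp: fibre_def positions_def)
  have "{..<m} \<subseteq> switch_targets m w i \<union> ({i} \<union> bad_pairs m w \<union> ?Y)"
  proof
    fix j assume j: "j \<in> {..<m}"
    show "j \<in> switch_targets m w i \<union> ({i} \<union> bad_pairs m w \<union> ?Y)"
    proof (cases "w (j, False) \<in> X \<or> w (j, True) \<in> X")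
      case True
      then show ?thesis using Y j by blast
    next
      case False
      then show ?thesis using j by (auto simp: switch_targets_def X_def)
    qed
  qed
  then have "card {..<m} \<le> card (switch_targets m w i \<union> ({i} \<union> bad_pairs m w \<union> ?Y))"
    using finX by (intro card_mono) (auto simp: switch_targets_def)
  also have "\<dots> \<le> card (switch_targets m w i) + card ({i} \<union> bad_pairs m w \<union> ?Y)"
    by (rule card_Un_le)
  also have "\<dots> \<le> card (switch_targets m w i) + (card ({i} \<union> bad_pairs m w) + card ?Y)"
    by (intro add_mono card_Un_le le_refl)
  also have "\<dots> \<le> card (switch_targets m w i) + (1 + card (bad_pairs m w) + (2 * d + 2) * d)"
    using cY card_Un_le[of "{i}" "bad_pairs m w"] by (intro add_mono le_refl) auto
  finally show ?thesis by simp
qed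

text \<open>
  The pairs \<open>j\<close> with which \<open>i\<close> can have been exchanged when \<open>w\<close> is the result of a switching:
  undoing the exchange must make \<open>i\<close> a loop, or parallel to an existing edge.
\<close>

definition switch_sources :: "nat \<Rightarrow> (nat \<times> bool \<Rightarrow> nat) \<Rightarrow> nat \<Rightarrow> nat set" where
  "switch_sources m w i =
     {j \<in> {..<m}. w (j, False) = w (i, True) \<or> w (j, False) \<in> neighbours m w (w (i, True))}"

lemma card_switch_sources_le:
  assumes "w \<in> words n d m"
  shows "card (switch_sources m w i) \<le> d + d * d"
proof -
  let ?v = "w (i, True)"
  let ?S = "fibre m w ?v \<union> (\<Union>x\<in>neighbours m w ?v. fibre m w x)"
  have "switch_sources m w i \<subseteq> fst ` ?S"
  proof
    fix j assume "j \<in> switch_sources m w i"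
    then have "(j, False) \<in> ?S"
      by (auto simp: switch_sources_def fibre_def positions_def)
    then show "j \<in> fst ` ?S" by (rule image_eqI[rotated]) simp
  qed
  then have "card (switch_sources m w i) \<le> card (fst ` ?S)" by (intro card_mono) auto
  also have "\<dots> \<le> card ?S" by (rule card_image_le) auto
  also have "\<dots> \<le> card (fibre m w ?v) + card (\<Union>x\<in>neighbours m w ?v. fibre m w x)" by (rule card_Un_le)
  also have "\<dots> \<le> card (fibre m w ?v) + (\<Sum>x\<in>neighbours m w ?v. card (fibre m w x))"
    by (intro add_left_mono card_UN_le) auto
  also have "\<dots> \<le> d + (\<Sum>x\<in>neighbours m w ?v. d)"
    by (intro add_mono sum_mono card_fibre_le[OF assms])
  also have "\<dots> \<le> d + d * d" using card_neighbours_le[OF assms] by simp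
  finally show ?thesis .
qed

lemma switch_bad_pairs:
  assumes i: "i \<in> bad_pairs m w" and j: "j \<in> switch_targets m w i"
  defines "w' \<equiv> swap_at w (i, False) (j, False)"
  shows "bad_pairs m w' \<subseteq> bad_pairs m w - {i}" "j \<in> switch_sources m w' i"
proof -
  define a b c e where abce: "a = w (i, False)" "b = w (i, True)" "c = w (j, False)" "e = w (j, True)"
  have ij: "i < m" "j < m" "j \<noteq> i" "j \<notin> bad_pairs m w"
    and c: "c \<notin> neighbours m w b" "c \<noteq> a" "c \<noteq> b"
    and e: "e \<notin> neighbours m w a" "e \<noteq> a" "e \<noteq> b"
    using i j by (auto simp: switch_targets_def bad_pairs_def abce)
  have ce: "c \<noteq> e" using ij by (auto simp: bad_pairs_def abce)
  have w': "w' (i, False) = c" "w' (i, True) = b" "w' (j, False) = a" "w' (j, True) = e"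
    "\<And>k b. k \<noteq> i \<Longrightarrow> k \<noteq> j \<Longrightarrow> w' (k, b) = w (k, b)"
    using ij by (auto simp: w'_def abce Transposition.transpose_def)
  have pe: "pair_edge w' i = {c, b}" "pair_edge w' j = {a, e}"
    "\<And>k. k \<noteq> i \<Longrightarrow> k \<noteq> j \<Longrightarrow> pair_edge w' k = pair_edge w k"
    using w' by (auto simp: pair_edge_def)
  \<comment> \<open>After the switching, \<open>i\<close> carries \<open>{c, b}\<close> and \<open>j\<close> carries \<open>{a, e}\<close>; both edges are new.\<close>
  have ne_ij: "{c, b} \<noteq> {a, e}" using c ce by (auto simp: doubleton_eq_iff)
  have ne_i: "pair_edge w k \<noteq> {c, b}" if "k < m" for k
    using c(1) neighbours_if_pair_edge[OF that] by blast
  have ne_j: "pair_edge w k \<noteq> {a, e}" if "k < m" for k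
    using e(1) neighbours_if_pair_edge[OF that] by (metis insert_commute)
  have i': "i \<notin> bad_pairs m w'"
  proof
    assume "i \<in> bad_pairs m w'"
    then obtain k where k: "k < m" "k \<noteq> i" "pair_edge w' k = {c, b}"
      using c(3) w' pe(1) by (auto simp: bad_pairs_def)
    then show False using pe ne_ij ne_i[OF k(1)] by (cases "k = j") auto
  qed
  have j': "j \<notin> bad_pairs m w'"
  proof
    assume "j \<in> bad_pairs m w'"
    then obtain k where k: "k < m" "k \<noteq> j" "pair_edge w' k = {a, e}"
      using e(2) w' pe(2) by (auto simp: bad_pairs_def)
    then show False using pe ne_ij ne_j[OF k(1)] by (cases "k = i") auto
  qed
  show "bad_pairs m w' \<subseteq> bad_pairs m w - {i}"
  proof
    fix k assume k: "k \<in> bad_pairs m w'"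
    then have kij: "k < m" "k \<noteq> i" "k \<noteq> j" using i' j' by (auto simp: bad_pairs_def)
    from k consider "w' (k, False) = w' (k, True)"
      | l where "l < m" "l \<noteq> k" "pair_edge w' l = pair_edge w' k"
      by (auto simp: bad_pairs_def)
    then have "k \<in> bad_pairs m w"
    proof cases
      case 1
      then show ?thesis using kij w'(5) by (simp add: bad_pairs_def)
    next
      case 2
      have "l \<noteq> i" "l \<noteq> j"
        using 2 kij pe ne_i[OF kij(1)] ne_j[OF kij(1)] by auto
      then have "pair_edge w l = pair_edge w k" using 2 kij pe(3) by simp
      then show ?thesis using 2 kij by (auto simp: bad_pairs_def)
    qed
    then show "k \<in> bad_pairs m w - {i}" using kij by simp
  qed
  show "j \<in> switch_sources m w' i"
  proof (cases "a = b")
    case True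
    then show ?thesis using ij w' by (simp add: switch_sources_def)
  next
    case False
    then obtain k where k: "k < m" "k \<noteq> i" "pair_edge w k = {a, b}"
      using i by (auto simp: bad_pairs_def abce pair_edge_def)
    have "k \<noteq> j"
      using k ij by (auto simp: bad_pairs_def pair_edge_def abce)
    then have "pair_edge w' k = {a, b}" using k pe(3) by simp
    then have "a \<in> neighbours m w' b" using neighbours_if_pair_edge[OF k(1)] by blast
    then show ?thesis using ij w' by (simp add: switch_sources_def)
  qed
qed

text \<open>
  Double counting of switchings. A word with \<open>t\<close> bad pairs admits at least \<open>m / 2\<close> switchings at any
  of its bad pairs; a word is the result of at most \<open>m (d + d^2)\<close> switchings.
\<close>

lemma card_bad_level_le:
  assumes "t > 0" "m \<ge> 2 * (1 + t + (2 * d + 2) * d)"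
  shows "card {w \<in> words n d m. card (bad_pairs m w) = t}
     \<le> 2 * (d + d * d) * card {w \<in> words n d m. card (bad_pairs m w) < t}"
proof -
  let ?B = "{w \<in> words n d m. card (bad_pairs m w) = t}"
  let ?L = "{w \<in> words n d m. card (bad_pairs m w) < t}"
  \<comment> \<open>\<open>C0\<close> bounds the number of pairs unsuitable for a switching.\<close>
  define C0 where "C0 = 1 + t + (2 * d + 2) * d"
  let ?X = "SIGMA w:?B. SIGMA i:bad_pairs m w. switch_targets m w i"
  let ?Y = "SIGMA w:?L. SIGMA i:{..<m}. switch_sources m w i"
  define f where "f = (\<lambda>(w, i, j). (swap_at w (i, False) (j, False), i :: nat, j :: nat))"
  have fin: "finite (switch_targets m w i)" "finite (switch_sources m w i)" for w i
    by (auto simp: switch_targets_def switch_sources_def)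
  have "card ?B * (m - C0) = (\<Sum>w\<in>?B. m - C0)" by (simp only: sum_constant of_nat_id)
  also have "\<dots> \<le> (\<Sum>w\<in>?B. card (SIGMA i:bad_pairs m w. switch_targets m w i))"
  proof (rule sum_mono)
    fix w assume w: "w \<in> ?B"
    then have "bad_pairs m w \<noteq> {}" using assms by auto
    then obtain i where i: "i \<in> bad_pairs m w" by blast
    have "m - C0 \<le> card (switch_targets m w i)"
      using card_switch_targets[of w n d m i] w by (simp add: C0_def)
    also have "\<dots> \<le> (\<Sum>i\<in>bad_pairs m w. card (switch_targets m w i))"
      using i by (intro member_le_sum) auto
    also have "\<dots> = card (SIGMA i:bad_pairs m w. switch_targets m w i)"
      using fin by (intro card_SigmaI[symmetric]) auto
    finally show "m - C0 \<le> card (SIGMA i:bad_pairs m w. switch_targets m w i)" .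
  qed
  also have "\<dots> = card ?X" using fin by (intro card_SigmaI[symmetric]) auto
  also have "\<dots> \<le> card ?Y"
  proof (rule card_inj_on_le[of f])
    show "inj_on f ?X"
    proof (rule inj_onI)
      fix x y assume eq: "f x = f y"
      obtain w i j w' i' j' where xy: "x = (w, i, j)" "y = (w', i', j')" by (metis prod_cases3)
      then have "i = i'" "j = j'" "swap_at w (i, False) (j, False) = swap_at w' (i, False) (j, False)"
        using eq by (auto simp: f_def)
      then show "x = y" unfolding xy by (metis swap_at_swap_at)
    qed
    show "f ` ?X \<subseteq> ?Y"
    proof (rule image_subsetI)
      fix x assume "x \<in> ?X"
      then obtain w i j where x: "x = (w, i, j)" and w: "w \<in> words n d m" "card (bad_pairs m w) = t"
        and ij: "i \<in> bad_pairs m w" "j \<in> switch_targets m w i" by auto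
      let ?w = "swap_at w (i, False) (j, False)"
      have lt: "i < m" "j < m" using ij by (auto simp: bad_pairs_def switch_targets_def)
      have "?w \<in> words n d m" using w lt by (intro swap_at_words) (auto simp: positions_def)
      moreover have "card (bad_pairs m ?w) < t"
      proof -
        have "card (bad_pairs m ?w) \<le> card (bad_pairs m w - {i})"
          by (intro card_mono switch_bad_pairs ij) auto
        also have "\<dots> < card (bad_pairs m w)" using ij by (intro card_Diff1_less) auto
        finally show ?thesis using w by simp
      qed
      moreover have "j \<in> switch_sources m ?w i" by (rule switch_bad_pairs(2)[OF ij])
      ultimately show "f x \<in> ?Y" using lt by (simp add: x f_def)
    qed
    show "finite ?Y" using fin by (intro finite_SigmaI) auto
  qed
  also have "card ?Y = (\<Sum>w\<in>?L. card (SIGMA i:{..<m}. switch_sources m w i))"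
    using fin by (intro card_SigmaI) auto
  also have "\<dots> = (\<Sum>w\<in>?L. \<Sum>i<m. card (switch_sources m w i))"
    using fin by (intro sum.cong refl card_SigmaI) auto
  also have "\<dots> \<le> (\<Sum>w\<in>?L. \<Sum>i<m. d + d * d)"
    by (intro sum_mono card_switch_sources_le[of _ n]) auto
  also have "\<dots> = card ?L * (m * (d + d * d))" by (simp only: sum_constant of_nat_id card_lessThan)
  finally have "card ?B * (m - C0) \<le> card ?L * (m * (d + d * d))" .
  moreover have "card ?B * m \<le> 2 * (card ?B * (m - C0))"
  proof -
    have "m \<le> 2 * (m - C0)" using assms by (simp add: C0_def)
    then have "card ?B * m \<le> card ?B * (2 * (m - C0))" by (rule mult_left_mono) simp
    then show ?thesis by (simp only: mult.left_commute)
  qed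
  ultimately have "card ?B * m \<le> 2 * (card ?L * (m * (d + d * d)))" by linarith
  also have "\<dots> = (2 * (d + d * d) * card ?L) * m" by (simp only: ac_simps)
  finally show ?thesis using assms by (simp only: mult_le_cancel2) simp
qed

text \<open>
  Lowering the number of bad pairs one level at a time, at most \<open>J\<close> times, loses a constant factor
  at each level.
\<close>

lemma positive_fraction_simple:
  assumes "d > 0"
  obtains c :: real and m0 where "c > 0"
    "\<And>n m. m0 \<le> m \<Longrightarrow> c * real (card (words n d m)) \<le> real (card {w \<in> words n d m. bad_pairs m w = {}})"
proof -
  define J where "J = 2 * (d + 2 * d ^ 2)"
  define K where "K = 1 + 2 * (d + d * d)"
  define m0 where "m0 = 3 + 2 * (1 + J + (2 * d + 2) * d)"
  have main: "card (words n d m) \<le> 2 * K ^ J * card {w \<in> words n d m. bad_pairs m w = {}}" if "m0 \<le> m" for n m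
  proof -
    let ?L = "\<lambda>t. {w \<in> words n d m. card (bad_pairs m w) < t}"
    have step: "card (?L (Suc t)) \<le> K * card (?L t)" if "0 < t" "t \<le> J" for t
    proof -
      have "?L (Suc t) = {w \<in> words n d m. card (bad_pairs m w) = t} \<union> ?L t" by auto
      then have "card (?L (Suc t)) = card ({w \<in> words n d m. card (bad_pairs m w) = t} \<union> ?L t)"
        by (rule arg_cong)
      also have "\<dots> \<le> card {w \<in> words n d m. card (bad_pairs m w) = t} + card (?L t)"
        by (rule card_Un_le)
      also have "card {w \<in> words n d m. card (bad_pairs m w) = t} \<le> 2 * (d + d * d) * card (?L t)"
        using that \<open>m0 \<le> m\<close> by (intro card_bad_level_le) (auto simp: m0_def)
      finally show ?thesis by (simp add: K_def)
    qed
    have it: "t \<le> J \<Longrightarrow> card (?L (Suc t)) \<le> K ^ t * card (?L 1)" for t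
    proof (induction t)
      case (Suc t)
      have "card (?L (Suc (Suc t))) \<le> K * card (?L (Suc t))" using Suc by (intro step) auto
      also have "\<dots> \<le> K * (K ^ t * card (?L 1))" using Suc by (intro mult_left_mono) auto
      finally show ?case by simp
    qed simp
    have "card (words n d m) \<le> 2 * card {w \<in> words n d m. card (bad_pairs m w) \<le> J}"
      using that assms by (intro half_words_few_bad_pairs) (auto simp: m0_def J_def)
    also have "{w \<in> words n d m. card (bad_pairs m w) \<le> J} = ?L (Suc J)" by auto
    also have "card (?L (Suc J)) \<le> K ^ J * card (?L 1)" by (rule it) simp
    also have "?L 1 = {w \<in> words n d m. bad_pairs m w = {}}" by auto
    finally show ?thesis by simp
  qed
  show thesis
  proof (rule that[of "1 / (2 * real K ^ J)" m0])
    have "K > 0" unfolding K_def by linarith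
    then have K: "real K > 0" by (simp only: of_nat_0_less_iff)
    then show "1 / (2 * real K ^ J) > 0" by simp
    fix n m assume "m0 \<le> m"
    then have "real (card (words n d m)) \<le> real (2 * K ^ J * card {w \<in> words n d m. bad_pairs m w = {}})"
      using main by (simp only: of_nat_le_iff)
    moreover have "real K ^ J > 0" using K by simp
    ultimately show "1 / (2 * real K ^ J) * real (card (words n d m)) \<le> real (card {w \<in> words n d m. bad_pairs m w = {}})"
      by (simp add: field_simps)
  qed
qed

section \<open>From words to regular graphs\<close>

definition word_graph :: "nat \<Rightarrow> (nat \<times> bool \<Rightarrow> nat) \<Rightarrow> nat set set" where
  "word_graph m w = pair_edge w ` {..<m}"

lemma bad_pairs_empty_iff:
  "bad_pairs m w = {} \<longleftrightarrow> (\<forall>i<m. w (i, False) \<noteq> w (i, True)) \<and> inj_on (pair_edge w) {..<m}"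
  unfolding bad_pairs_def inj_on_def by auto

lemma in_pair_edge_iff: "v \<in> pair_edge w i \<longleftrightarrow> (\<exists>b. w (i, b) = v)"
  by (auto simp: pair_edge_def ex_bool_eq)

text \<open>The absence of loops and repeated edges makes the map from positions to edges injective on the
  positions of each letter.\<close>

lemma vertex_degree_word_graph:
  assumes "bad_pairs m w = {}"
  shows "vertex_degree (word_graph m w) v = card (fibre m w v)"
proof -
  have "bij_betw (\<lambda>p. pair_edge w (fst p)) (fibre m w v) {e \<in> word_graph m w. v \<in> e}"
    unfolding bij_betw_def
  proof
    show "inj_on (\<lambda>p. pair_edge w (fst p)) (fibre m w v)"
    proof (rule inj_onI)
      fix p q assume p: "p \<in> fibre m w v" and q: "q \<in> fibre m w v"
        and eq: "pair_edge w (fst p) = pair_edge w (fst q)"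
      have "fst p = fst q"
        using p q eq assms unfolding bad_pairs_empty_iff
        by (auto simp: fibre_def positions_def dest: inj_onD)
      moreover have "snd p = snd q"
      proof (rule ccontr)
        assume "snd p \<noteq> snd q"
        then have "w (fst p, False) = v \<and> w (fst p, True) = v"
          using p q \<open>fst p = fst q\<close> by (cases p; cases q; cases "snd p") (auto simp: fibre_def)
        then show False using p assms unfolding bad_pairs_empty_iff
          by (auto simp: fibre_def positions_def)
      qed
      ultimately show "p = q" by (rule prod_eqI)
    qed
    show "(\<lambda>p. pair_edge w (fst p)) ` fibre m w v = {e \<in> word_graph m w. v \<in> e}"
    proof (intro set_eqI iffI)
      fix e assume "e \<in> {e \<in> word_graph m w. v \<in> e}"
      then obtain i b where "i < m" "e = pair_edge w i" "w (i, b) = v"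
        by (auto simp: word_graph_def in_pair_edge_iff)
      then show "e \<in> (\<lambda>p. pair_edge w (fst p)) ` fibre m w v"
        by (intro image_eqI[of _ _ "(i, b)"]) (auto simp: fibre_def positions_def)
    qed (auto simp: fibre_def positions_def word_graph_def in_pair_edge_iff)
  qed
  then show ?thesis unfolding vertex_degree_def by (metis bij_betw_same_card)
qed

lemma word_graph_regular:
  assumes "w \<in> words n d m" "bad_pairs m w = {}"
  shows "word_graph m w \<in> regular_graphs n d"
proof -
  have "pair_edge w i \<subseteq> {..<n}" "card (pair_edge w i) = 2" if "i < m" for i
    using that assms(2) words_less[OF assms(1), of "(i, False)"] words_less[OF assms(1), of "(i, True)"]
    by (auto simp: pair_edge_def positions_def bad_pairs_empty_iff card_insert_if)
  then have "word_graph m w \<subseteq> {e. e \<subseteq> {..<n} \<and> card e = 2}" by (auto simp: word_graph_def)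
  then show ?thesis
    using vertex_degree_word_graph[OF assms(2)] card_fibre[OF assms(1)]
    by (simp add: regular_graphs_def)
qed

lemma finite_regular_graphs [simp]: "finite (regular_graphs n d)"
  by (rule finite_subset[of _ "Pow (Pow {..<n})"]) (auto simp: regular_graphs_def)

lemma regular_graphs_finite_edges: "E \<in> regular_graphs n d \<Longrightarrow> finite E"
  by (rule finite_subset[of _ "Pow {..<n}"]) (auto simp: regular_graphs_def)

lemma card_regular_graph:
  assumes "E \<in> regular_graphs n d"
  shows "2 * card E = d * n"
proof -
  have "(\<Sum>v<n. card {e \<in> E. v \<in> e}) = (\<Sum>e\<in>E. 2)"
  proof (rule sum_multicount_gen)
    show "\<forall>e\<in>E. card {v \<in> {..<n}. v \<in> e} = 2"
    proof
      fix e assume "e \<in> E"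
      then have "e \<subseteq> {..<n}" "card e = 2" using assms by (auto simp: regular_graphs_def)
      then have "{v \<in> {..<n}. v \<in> e} = e" by auto
      then show "card {v \<in> {..<n}. v \<in> e} = 2" using \<open>card e = 2\<close> by simp
    qed
  qed (use assms regular_graphs_finite_edges in auto)
  moreover have "(\<Sum>v<n. card {e \<in> E. v \<in> e}) = (\<Sum>v<n. d)"
    using assms by (intro sum.cong) (auto simp: regular_graphs_def vertex_degree_def)
  ultimately show ?thesis by (simp add: mult.commute)
qed

definition representations :: "nat \<Rightarrow> nat \<Rightarrow> nat \<Rightarrow> nat set set \<Rightarrow> (nat \<times> bool \<Rightarrow> nat) set" where
  "representations n d m E = {w \<in> words n d m. bad_pairs m w = {} \<and> word_graph m w = E}"

lemma card2_Min_Max: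
  fixes e :: "nat set"
  assumes "card e = 2"
  shows "Min e < Max e" "e = {Min e, Max e}"
proof -
  obtain a b where "e = {a, b}" "a \<noteq> b" using assms by (auto simp: card_2_iff)
  then show "Min e < Max e" "e = {Min e, Max e}" by (auto simp: min_def max_def)
qed

text \<open>
  A bijection between the edge sets of two regular graphs, applied to each pair of a word with the
  order of the two letters kept, sends representations of one graph to those of the other. By
  symmetry all simple regular graphs have equally many representations.
\<close>

lemma card_representations_le:
  assumes "E \<in> regular_graphs n d" "E' \<in> regular_graphs n d"
  shows "card (representations n d m E) \<le> card (representations n d m E')"
proof -
  have "card E = card E'" using card_regular_graph[OF assms(1)] card_regular_graph[OF assms(2)] by simp
  then obtain \<phi> where \<phi>: "bij_betw \<phi> E E'"
    using finite_same_card_bij regular_graphs_finite_edges assms by metis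
  define \<Phi> where "\<Phi> w = restrict (\<lambda>(i, b). if (w (i, False) < w (i, True)) = b
      then Max (\<phi> (pair_edge w i)) else Min (\<phi> (pair_edge w i))) (positions m)"
    for w :: "nat \<times> bool \<Rightarrow> nat"
  have E': "card e = 2" "e \<subseteq> {..<n}" if "e \<in> E'" for e
    using that assms(2) by (auto simp: regular_graphs_def)
  have key: "pair_edge w i \<in> E" "\<phi> (pair_edge w i) \<in> E'" "pair_edge (\<Phi> w) i = \<phi> (pair_edge w i)"
      "\<Phi> w (i, False) \<noteq> \<Phi> w (i, True)"
      "\<Phi> w (i, False) < \<Phi> w (i, True) \<longleftrightarrow> w (i, False) < w (i, True)"
    if w: "w \<in> representations n d m E" and i: "i < m" for w i
  proof -
    show 1: "pair_edge w i \<in> E" using w i by (auto simp: representations_def word_graph_def)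
    then show 2: "\<phi> (pair_edge w i) \<in> E'" using bij_betwE[OF \<phi>] by blast
    note mm = card2_Min_Max[OF E'(1)[OF 2]]
    have vals: "\<Phi> w (i, b) = (if (w (i, False) < w (i, True)) = b
      then Max (\<phi> (pair_edge w i)) else Min (\<phi> (pair_edge w i)))" for b
      using i by (simp add: \<Phi>_def positions_def)
    show "\<Phi> w (i, False) \<noteq> \<Phi> w (i, True)"
      "\<Phi> w (i, False) < \<Phi> w (i, True) \<longleftrightarrow> w (i, False) < w (i, True)"
      using mm(1) by (simp_all add: vals)
    have "pair_edge (\<Phi> w) i = {Min (\<phi> (pair_edge w i)), Max (\<phi> (pair_edge w i))}"
      by (simp add: pair_edge_def[of "\<Phi> w"] vals insert_commute)
    then show "pair_edge (\<Phi> w) i = \<phi> (pair_edge w i)" using mm(2) by simp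
  qed
  show ?thesis
  proof (rule card_inj_on_le[of \<Phi>])
    show "finite (representations n d m E')" by (simp add: representations_def)
    show "inj_on \<Phi> (representations n d m E)"
    proof (rule inj_onI)
      fix w w' assume w: "w \<in> representations n d m E" and w': "w' \<in> representations n d m E"
        and eq: "\<Phi> w = \<Phi> w'"
      have "w (i, b) = w' (i, b)" if i: "i < m" for i b
      proof -
        have "\<phi> (pair_edge w i) = \<phi> (pair_edge w' i)"
          using key(3)[OF w i] key(3)[OF w' i] eq by simp
        then have "pair_edge w i = pair_edge w' i"
          using \<phi> key(1)[OF w i] key(1)[OF w' i] by (auto simp: bij_betw_def dest: inj_onD)
        moreover have "w (i, False) < w (i, True) \<longleftrightarrow> w' (i, False) < w' (i, True)"
          using key(5)[OF w i] key(5)[OF w' i] eq by simp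
        ultimately show ?thesis
          by (cases b) (auto simp: pair_edge_def doubleton_eq_iff)
      qed
      then have "w p = w' p" if "p \<in> positions m" for p
        using that by (cases p) (auto simp: positions_def)
      moreover have "w \<in> extensional (positions m)" "w' \<in> extensional (positions m)"
        using w w' by (auto simp: representations_def words_def PiE_def)
      ultimately show "w = w'" by (rule extensionalityI[rotated 2])
    qed
    show "\<Phi> ` representations n d m E \<subseteq> representations n d m E'"
    proof (rule image_subsetI)
      fix w assume w: "w \<in> representations n d m E"
      have inj: "inj_on (pair_edge w) {..<m}" and gr: "word_graph m w = E"
        using w by (auto simp: representations_def bad_pairs_empty_iff)
      have "inj_on (pair_edge (\<Phi> w)) {..<m}"
      proof (rule inj_onI)
        fix i j assume ij: "i \<in> {..<m}" "j \<in> {..<m}" "pair_edge (\<Phi> w) i = pair_edge (\<Phi> w) j"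
        then have "pair_edge w i = pair_edge w j"
          using key(1)[OF w, of i] key(1)[OF w, of j] key(3)[OF w, of i] key(3)[OF w, of j]
            inj_onD[OF bij_betw_imp_inj_on[OF \<phi>]] by simp
        then show "i = j" using inj ij by (auto dest: inj_onD)
      qed
      then have nb: "bad_pairs m (\<Phi> w) = {}"
        using key(4)[OF w] by (auto simp: bad_pairs_empty_iff)
      have "word_graph m (\<Phi> w) = \<phi> ` word_graph m w"
        using key(3)[OF w] by (auto simp: word_graph_def image_image)
      then have g: "word_graph m (\<Phi> w) = E'" using gr \<phi> by (simp add: bij_betw_def)
      have "\<Phi> w (i, b) < n" if "i < m" for i b
      proof -
        have "\<Phi> w (i, b) \<in> \<phi> (pair_edge w i)"
          using key(3)[OF w that] in_pair_edge_iff[of "\<Phi> w (i, b)" "\<Phi> w" i] by auto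
        then show ?thesis using E'(2) key(2)[OF w that] by auto
      qed
      then have "\<Phi> w \<in> positions m \<rightarrow>\<^sub>E {..<n}"
        by (intro PiE_I) (auto simp: positions_def \<Phi>_def)
      moreover have "card (fibre m (\<Phi> w) v) = d" if "v < n" for v
        using vertex_degree_word_graph[OF nb, of v] g assms(2) that by (auto simp: regular_graphs_def)
      ultimately show "\<Phi> w \<in> representations n d m E'"
        using nb g by (auto simp: representations_def words_def)
    qed
  qed
qed

lemma card_graphs_words:
  "card {E \<in> regular_graphs n d. Q E} * card {w \<in> words n d m. bad_pairs m w = {}}
   = card {w \<in> words n d m. bad_pairs m w = {} \<and> Q (word_graph m w)} * card (regular_graphs n d)"
proof -
  let ?W = "{w \<in> words n d m. bad_pairs m w = {}}"
  let ?G = "regular_graphs n d"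
  let ?c = "\<lambda>E. card (representations n d m E)"
  have count: "card {w \<in> ?W. word_graph m w \<in> F} = (\<Sum>E\<in>F. ?c E)" if "finite F" for F
    using that by (subst card_preimage_sum) (auto simp: representations_def conj_assoc)
  have "?W = {w \<in> ?W. word_graph m w \<in> ?G}" using word_graph_regular by auto
  then have W: "card ?W = (\<Sum>E\<in>?G. ?c E)" using count[of ?G] by simp
  have "{w \<in> words n d m. bad_pairs m w = {} \<and> Q (word_graph m w)} = {w \<in> ?W. word_graph m w \<in> {E \<in> ?G. Q E}}"
    using word_graph_regular by auto
  then have "card {w \<in> words n d m. bad_pairs m w = {} \<and> Q (word_graph m w)} * card ?G
      = (\<Sum>E\<in>{E \<in> ?G. Q E}. \<Sum>E'\<in>?G. ?c E)"
    using count[of "{E \<in> ?G. Q E}"] by (simp add: sum_distrib_left mult.commute)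
  also have "\<dots> = (\<Sum>E\<in>{E \<in> ?G. Q E}. \<Sum>E'\<in>?G. ?c E')"
    by (intro sum.cong refl antisym card_representations_le) auto
  also have "\<dots> = card {E \<in> ?G. Q E} * card ?W" by (simp add: W)
  finally show ?thesis by simp
qed

lemma edge_boundary_word_graph:
  assumes "bad_pairs m w = {}"
  shows "card (edge_boundary (word_graph m w) U) = card (split_pairs m (word_pattern m w U))"
proof -
  have "card ({a, b} \<inter> U) = 1 \<longleftrightarrow> (a \<in> U) \<noteq> (b \<in> U)" if "a \<noteq> b" for a b :: nat
    using that by (cases "a \<in> U"; cases "b \<in> U") auto
  then have "card (pair_edge w i \<inter> U) = 1 \<longleftrightarrow> i \<in> split_pairs m (word_pattern m w U)" if "i < m" for i
    using that assms by (auto simp: bad_pairs_empty_iff pair_edge_def split_pairs_def word_pattern_def positions_def)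
  then have "edge_boundary (word_graph m w) U = pair_edge w ` split_pairs m (word_pattern m w U)"
    by (auto simp: edge_boundary_def word_graph_def split_pairs_def)
  moreover have "inj_on (pair_edge w) (split_pairs m (word_pattern m w U))"
    using assms by (auto simp: bad_pairs_empty_iff split_pairs_def intro: inj_on_subset)
  ultimately show ?thesis by (simp add: card_image)
qed

section \<open>Expected number of sets with small boundary\<close>

lemma self_power_xlogx: "real k ^ k = exp (xlogx (real k))"
proof (cases "k = 0")
  case False
  then have "real k ^ k = exp (ln (real k)) ^ k" by simp
  also have "\<dots> = exp (real k * ln (real k))" by (simp only: exp_of_nat_mult)
  finally show ?thesis by (simp add: xlogx_def)
qed simp

lemma binomial_le_exp_xlogx:
  "real ((a + b) choose a) \<le> exp (xlogx (real (a + b)) - xlogx (real a) - xlogx (real b))"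
proof -
  have "real ((a + b) choose a) * exp (xlogx (real a) + xlogx (real b)) \<le> exp (xlogx (real (a + b)))"
    using binomial_le_entropy[of a b] unfolding self_power_xlogx by (simp only: exp_add mult.assoc)
  then show ?thesis by (simp add: exp_diff exp_add field_simps)
qed

lemma exp_xlogx_le_binomial:
  "exp (xlogx (real (a + b)) - xlogx (real a) - xlogx (real b)) \<le> real (a + b + 1) * real ((a + b) choose a)"
proof -
  have "exp (xlogx (real (a + b))) \<le> real (a + b + 1) * real ((a + b) choose a) * exp (xlogx (real a) + xlogx (real b))"
    using entropy_le_binomial[of a b] unfolding self_power_xlogx by (simp only: exp_add mult.assoc)
  then show ?thesis by (simp add: exp_diff exp_add field_simps)
qed

text \<open>
  The three brackets are the exponents of the entropy estimates for \<open>n choose k\<close>, for the number of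
  patterns with \<open>y\<close> split pairs, and for \<open>2m choose dk\<close>. The terms with \<open>ln n\<close> cancel, so nothing but
  \<open>f_hat\<close> remains after division by \<open>n\<close>.
\<close>

lemma f_hat_scaled:
  assumes n: "n > 0" and d: "d > 0" and k: "0 \<le> k" "k \<le> n" and y: "0 \<le> y" "y \<le> real d * k" "y \<le> real d * (n - k)"
  shows "n * f_hat d (k / n) (y / n)
    = (xlogx n - xlogx k - xlogx (n - k))
      + (xlogx (real d * n / 2) - xlogx y - xlogx ((real d * k - y) / 2) - xlogx ((real d * (n - k) - y) / 2) + y * ln 2)
      - (xlogx (real d * n) - xlogx (real d * k) - xlogx (real d * (n - k)))"
proof -
  have scale: "n * xlogx (x / n) = xlogx x - x * ln n" if "x \<ge> 0" for x
    using xlogx_mult[of n "x / n"] n that by simp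
  have half: "xlogx (x / 2) = xlogx x / 2 - x / 2 * ln 2" if "x \<ge> 0" for x
    using xlogx_mult[of 2 "x / 2"] that by (simp add: field_simps)
  have e: "real d * (k / n) = (real d * k) / n" "real d - (real d * k) / n = (real d * (n - k)) / n"
    "1 - k / n = (n - k) / n" "(real d * k) / n - y / n = (real d * k - y) / n"
    "(real d * (n - k)) / n - y / n = (real d * (n - k) - y) / n"
    using n by (auto simp: field_simps)
  have dn: "xlogx (real d) * n = xlogx (real d * n) - real d * n * ln n"
    using scale[of "real d * n"] n by (simp add: mult.commute)
  have "n * f_hat d (k / n) (y / n) =
      n * xlogx ((real d * k) / n) + n * xlogx ((real d * (n - k)) / n) - n * xlogx (k / n) - n * xlogx ((n - k) / n)
      - n * xlogx (y / n) - 1/2 * (n * xlogx ((real d * k - y) / n) + n * xlogx ((real d * (n - k) - y) / n) + xlogx (real d) * n)"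
    unfolding f_hat_def e by (simp add: distrib_left right_diff_distrib)
  also have "\<dots> = (xlogx (real d * k) - real d * k * ln n) + (xlogx (real d * (n - k)) - real d * (n - k) * ln n)
      - (xlogx k - k * ln n) - (xlogx (n - k) - (n - k) * ln n) - (xlogx y - y * ln n)
      - 1/2 * ((xlogx (real d * k - y) - (real d * k - y) * ln n)
         + (xlogx (real d * (n - k) - y) - (real d * (n - k) - y) * ln n) + (xlogx (real d * n) - real d * n * ln n))"
  proof -
    have nn: "0 \<le> real d * k" "0 \<le> real d * (n - k)" "0 \<le> n - k" "0 \<le> real d * k - y" "0 \<le> real d * (n - k) - y"
      using k y by auto
    show ?thesis
      unfolding scale[OF nn(1)] scale[OF nn(2)] scale[OF nn(3)] scale[OF nn(4)] scale[OF nn(5)]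
        scale[OF k(1)] scale[OF y(1)] dn ..
  qed
  also have "\<dots> = xlogx (real d * k) + xlogx (real d * (n - k)) - xlogx k - xlogx (n - k) - xlogx y
      - 1/2 * (xlogx (real d * k - y) + xlogx (real d * (n - k) - y) + xlogx (real d * n)) + xlogx n"
    using scale[of n] n by (simp add: xlogx_def[of n] algebra_simps)
  also have "\<dots> = (xlogx n - xlogx k - xlogx (n - k))
      + (xlogx (real d * n / 2) - xlogx y - xlogx ((real d * k - y) / 2) - xlogx ((real d * (n - k) - y) / 2) + y * ln 2)
      - (xlogx (real d * n) - xlogx (real d * k) - xlogx (real d * (n - k)))"
  proof -
    have nn: "0 \<le> real d * n" "0 \<le> real d * k - y" "0 \<le> real d * (n - k) - y"
      using k y n by auto
    show ?thesis
      unfolding half[OF nn(1)] half[OF nn(2)] half[OF nn(3)]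
      by (simp add: algebra_simps add_divide_distrib diff_divide_distrib)
  qed
  finally show ?thesis .
qed

text \<open>
  After division by \<open>2m choose dk\<close> this bounds the expected number of sets of \<open>k\<close> vertices with \<open>y\<close>
  boundary edges and \<open>i\<close> inner edges.
\<close>

lemma expected_count_le:
  assumes "d > 0" "n > 0" "d * n = 2 * m" "d * k = 2 * i + y" "y + i \<le> m" "k \<le> n"
  shows "real (n choose k) * real ((m choose y) * 2 ^ y * ((m - y) choose i))
     \<le> real (2 * m + 1) * exp (real n * f_hat d (real k / real n) (real y / real n))
        * real ((2 * m) choose (d * k))"
proof -
  define j where "j = m - (y + i)"
  define h where "h = n - k"
  have m: "m = y + (i + j)" and n: "n = k + h" using assms by (auto simp: j_def h_def)
  have dh: "d * h = 2 * j + y" using assms(3,4) unfolding m n by (simp add: algebra_simps)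
  have m2: "2 * m = d * k + d * h" using assms(3) unfolding n by (simp add: algebra_simps)
  let ?X = "\<lambda>x. xlogx (real x)"
  define P1 where "P1 = ?X n - ?X k - ?X h"
  define P2 where "P2 = ?X m - ?X y - ?X (i + j)"
  define P3 where "P3 = ?X (i + j) - ?X i - ?X j"
  define P4 where "P4 = ?X (2 * m) - ?X (d * k) - ?X (d * h)"
  have b1: "real (n choose k) \<le> exp P1"
    using binomial_le_exp_xlogx[of k h] unfolding P1_def n .
  have b2: "real (m choose y) \<le> exp P2"
    using binomial_le_exp_xlogx[of y "i + j"] unfolding P2_def m .
  have b3: "real ((m - y) choose i) \<le> exp P3"
    using binomial_le_exp_xlogx[of i j] unfolding P3_def m by simp
  have b4: "exp P4 \<le> real (2 * m + 1) * real ((2 * m) choose (d * k))"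
    using exp_xlogx_le_binomial[of "d * k" "d * h"] unfolding P4_def m2 .
  have "real n * f_hat d (real k / real n) (real y / real n) =
     (?X n - ?X k - xlogx (real n - real k))
      + (xlogx (real d * real n / 2) - ?X y - xlogx ((real d * real k - real y) / 2)
          - xlogx ((real d * (real n - real k) - real y) / 2) + real y * ln 2)
      - (xlogx (real d * real n) - xlogx (real d * real k) - xlogx (real d * (real n - real k)))"
  proof (rule f_hat_scaled)
    have "y \<le> d * k" "y \<le> d * h" using assms(4) dh by auto
    then have "real y \<le> real (d * k)" "real y \<le> real (d * h)" by (simp_all only: of_nat_le_iff)
    then show "real y \<le> real d * real k" "real y \<le> real d * (real n - real k)" by (simp_all add: n)
  qed (use assms in auto)
  also have "\<dots> = P1 + (P2 + P3 + real y * ln 2) - P4"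
  proof -
    have r: "real n - real k = real h" "real d * real h = real (d * h)" "real d * real k = real (d * k)"
      "real d * real n = real (2 * m)"
      unfolding assms(3)[symmetric] by (simp_all add: n)
    have q: "(real (d * k) - real y) / 2 = real i" "(real (d * h) - real y) / 2 = real j" "real (2 * m) / 2 = real m"
      unfolding assms(4) dh by simp_all
    show ?thesis unfolding r q P1_def P2_def P3_def P4_def by simp
  qed
  finally have F: "exp (real n * f_hat d (real k / real n) (real y / real n)) * exp P4
      = exp P1 * (exp P2 * 2 ^ y * exp P3)"
    by (simp add: exp_add[symmetric] exp_diff exp_of_nat_mult mult.commute)
       (simp add: exp_add exp_of_nat_mult)
  have "real (n choose k) * real ((m choose y) * 2 ^ y * ((m - y) choose i))
      \<le> exp P1 * (exp P2 * 2 ^ y * exp P3)"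
    unfolding of_nat_mult of_nat_power of_nat_numeral
    using b1 b2 b3 by (intro mult_mono) auto
  also have "\<dots> = exp (real n * f_hat d (real k / real n) (real y / real n)) * exp P4"
    by (rule F[symmetric])
  also have "\<dots> \<le> exp (real n * f_hat d (real k / real n) (real y / real n)) * (real (2 * m + 1) * real ((2 * m) choose (d * k)))"
    by (intro mult_left_mono b4) simp
  finally show ?thesis by (simp only: ac_simps)
qed

lemma split_pairs_disjoint_card:
  "card (split_pairs m S) + card (full_pairs m S) \<le> m"
proof -
  have "card (split_pairs m S \<union> full_pairs m S) \<le> card {..<m}"
    by (intro card_mono) (auto simp: split_pairs_def full_pairs_def)
  moreover have "card (split_pairs m S \<union> full_pairs m S) = card (split_pairs m S) + card (full_pairs m S)"
    by (intro card_Un_disjoint) (auto simp: split_pairs_def full_pairs_def)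
  ultimately show ?thesis by simp
qed

definition few_split :: "nat \<Rightarrow> nat \<Rightarrow> real \<Rightarrow> (nat \<times> bool) set set" where
  "few_split m K t = {S \<in> patterns m K. real (card (split_pairs m S)) < t}"

text \<open>Suitable for \<open>k\<close> linear in \<open>n\<close>, where \<open>g\<close> is below a negative constant and beats the polynomial
  factor.\<close>

lemma few_split_large:
  assumes "d > 0" "n > 0" "d * n = 2 * m" "k \<le> n"
    and f: "\<And>y. 0 \<le> y \<Longrightarrow> y \<le> t \<Longrightarrow> f_hat d (real k / real n) (y / real n) \<le> g"
  shows "real (n choose k) * real (card (few_split m (d * k) t))
     \<le> real (m + 1) * real (2 * m + 1) * exp (real n * g) * real ((2 * m) choose (d * k))"
proof -
  let ?C = "\<lambda>y. {S \<in> patterns m (d * k). card (split_pairs m S) = y}"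
  define Y where "Y = {y. y \<le> m \<and> real y < t}"
  have "few_split m (d * k) t \<subseteq> (\<Union>y\<in>Y. ?C y)"
  proof
    fix S assume S: "S \<in> few_split m (d * k) t"
    then have "card (split_pairs m S) \<in> Y"
      using split_pairs_disjoint_card[of m S] by (auto simp: Y_def few_split_def)
    then show "S \<in> (\<Union>y\<in>Y. ?C y)" using S by (auto simp: few_split_def)
  qed
  then have "card (few_split m (d * k) t) \<le> card (\<Union>y\<in>Y. ?C y)"
    by (intro card_mono) (auto simp: Y_def)
  also have "\<dots> \<le> (\<Sum>y\<in>Y. card (?C y))" by (intro card_UN_le) (auto simp: Y_def)
  finally have "real (card (few_split m (d * k) t)) \<le> (\<Sum>y\<in>Y. real (card (?C y)))"
    by (simp only: of_nat_le_iff flip: of_nat_sum)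
  then have "real (n choose k) * real (card (few_split m (d * k) t))
      \<le> real (n choose k) * (\<Sum>y\<in>Y. real (card (?C y)))"
    by (intro mult_left_mono) auto
  also have "\<dots> = (\<Sum>y\<in>Y. real (n choose k) * real (card (?C y)))" by (simp only: sum_distrib_left)
  also have "\<dots> \<le> (\<Sum>y\<in>Y. real (2 * m + 1) * exp (real n * g) * real ((2 * m) choose (d * k)))"
  proof (rule sum_mono)
    fix y assume y: "y \<in> Y"
    show "real (n choose k) * real (card (?C y)) \<le> real (2 * m + 1) * exp (real n * g) * real ((2 * m) choose (d * k))"
    proof (cases "?C y = {}")
      case True
      show ?thesis unfolding True by simp
    next
      case False
      then obtain S where S: "S \<in> patterns m (d * k)" "card (split_pairs m S) = y" by auto
      define i where "i = card (full_pairs m S)"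
      have dk: "d * k = 2 * i + y" using S card_pattern[of S m] by (auto simp: i_def patterns_def)
      have im: "y + i \<le> m" using split_pairs_disjoint_card[of m S] S by (simp add: i_def)
      have "(d * k - y) div 2 = i" using dk by simp
      then have "real (card (?C y)) \<le> real ((m choose y) * 2 ^ y * ((m - y) choose i))"
        using card_patterns_split_le[of m "d * k" y] by (simp only: of_nat_le_iff)
      then have "real (n choose k) * real (card (?C y)) \<le> real (n choose k) * real ((m choose y) * 2 ^ y * ((m - y) choose i))"
        by (intro mult_left_mono) auto
      also have "\<dots> \<le> real (2 * m + 1) * exp (real n * f_hat d (real k / real n) (real y / real n)) * real ((2 * m) choose (d * k))"
        by (rule expected_count_le[OF assms(1-3) dk im assms(4)])
      also have "\<dots> \<le> real (2 * m + 1) * exp (real n * g) * real ((2 * m) choose (d * k))"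
      proof -
        have "real n * f_hat d (real k / real n) (real y / real n) \<le> real n * g"
          using y f[of "real y"] by (intro mult_left_mono) (auto simp: Y_def)
        then show ?thesis by (intro mult_right_mono mult_left_mono) auto
      qed
      finally show ?thesis .
    qed
  qed
  also have "\<dots> = real (card Y) * (real (2 * m + 1) * exp (real n * g) * real ((2 * m) choose (d * k)))"
    by simp
  also have "\<dots> \<le> real (m + 1) * (real (2 * m + 1) * exp (real n * g) * real ((2 * m) choose (d * k)))"
  proof (rule mult_right_mono)
    have "card Y \<le> card {..m}" by (intro card_mono) (auto simp: Y_def)
    then show "real (card Y) \<le> real (m + 1)" by (simp only: of_nat_le_iff card_atMost Suc_eq_plus1)
  qed simp
  finally show ?thesis by (simp only: ac_simps)
qed

text \<open>
  Suitable for \<open>k\<close> up to a small multiple of \<open>n\<close>. Few split pairs force at least \<open>r\<close> full pairs, where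
  \<open>r\<close> is \<open>(1 + e) k\<close> rounded up, and the probability of having \<open>r\<close> given full pairs is at most
  \<open>(k/n)^(2 r)\<close>. What remains is a power of \<open>k / n\<close> with exponent \<open>r - k\<close>. This exponent is at least
  \<open>1\<close> and at least \<open>e k\<close>; using the mean of the two bounds treats bounded and unbounded \<open>k\<close> together.
\<close>

lemma few_split_small:
  assumes "d \<ge> 2" "0 < n" "d * n = 2 * m" "0 < k" "k \<le> n" "0 < e" "e \<le> 1"
    and t: "t \<le> (real d - 2 - 2 * e) * real k"
  shows "real (n choose k) * real (card (few_split m (d * k) t))
     \<le> (exp 1 * (exp 1 * real d / 2) ^ 2) ^ k * (real k / real n) powr ((1 + e * real k) / 2)
        * real ((2 * m) choose (d * k))"
proof -
  define r where "r = nat \<lceil>(1 + e) * real k\<rceil>"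
  have r_ge: "(1 + e) * real k \<le> real r" unfolding r_def by linarith
  have "(1 + e) * real k \<le> real (2 * k)" using assms by (simp add: mult_right_mono)
  then have "\<lceil>(1 + e) * real k\<rceil> \<le> int (2 * k)" by (simp only: ceiling_le_iff of_int_of_nat_eq)
  then have r_le: "r \<le> 2 * k" unfolding r_def by linarith
  have "e * real k > 0" using assms by simp
  then have "real k < real r" using r_ge by (simp add: algebra_simps)
  then have kr: "k < r" by simp
  have m0: "0 < m" using assms by (cases m) auto
  have cover: "few_split m (d * k) t \<subseteq> {S \<in> patterns m (d * k). r \<le> card (full_pairs m S)}"
  proof safe
    fix S assume S: "S \<in> few_split m (d * k) t"
    then show "S \<in> patterns m (d * k)" by (simp add: few_split_def)
    then have "d * k = 2 * card (full_pairs m S) + card (split_pairs m S)"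
      using card_pattern[of S m] by (auto simp: patterns_def)
    then have "real d * real k = 2 * real (card (full_pairs m S)) + real (card (split_pairs m S))"
      by (metis of_nat_add of_nat_mult of_nat_numeral)
    moreover have "real (card (split_pairs m S)) < (real d - 2 - 2 * e) * real k"
      using S t by (auto simp: few_split_def)
    ultimately have "(1 + e) * real k \<le> real (card (full_pairs m S))"
      by (simp add: algebra_simps)
    then have "\<lceil>(1 + e) * real k\<rceil> \<le> int (card (full_pairs m S))"
      by (simp only: ceiling_le_iff of_int_of_nat_eq)
    then show "r \<le> card (full_pairs m S)" unfolding r_def by linarith
  qed
  have "d * k \<le> d * n" using assms(5) by simp
  then have dk: "d * k \<le> 2 * m" using assms by simp
  show ?thesis
  proof (cases "2 * r \<le> d * k")
    case False
    have "{S \<in> patterns m (d * k). r \<le> card (full_pairs m S)} = {}"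
    proof safe
      fix S assume "S \<in> patterns m (d * k)" "r \<le> card (full_pairs m S)"
      then show "S \<in> {}" using False card_pattern[of S m] by (auto simp: patterns_def)
    qed
    then have "few_split m (d * k) t = {}" using cover by auto
    then show ?thesis by simp
  next
    case True
    define x where "x = real k / real n"
    have x: "0 < x" "x \<le> 1" using assms by (auto simp: x_def)
    have "card (few_split m (d * k) t) \<le> card {S \<in> patterns m (d * k). r \<le> card (full_pairs m S)}"
      using cover by (intro card_mono) auto
    also have "\<dots> \<le> (m choose r) * ((2 * m - 2 * r) choose (d * k - 2 * r))"
      by (rule card_patterns_full_le[OF True dk])
    finally have "real (card (few_split m (d * k) t)) \<le> real (m choose r) * real ((2 * m - 2 * r) choose (d * k - 2 * r))"
      by (simp only: of_nat_le_iff flip: of_nat_mult)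
    also have "\<dots> \<le> real (m choose r) * ((real (d * k) / real (2 * m)) ^ (2 * r) * real ((2 * m) choose (d * k)))"
      using True dk m0 by (intro mult_left_mono binomial_shift_le) auto
    also have "real (d * k) / real (2 * m) = x"
      unfolding assms(3)[symmetric] x_def using assms(1,2) by simp
    also have "real (m choose r) \<le> (exp 1 * real m / real r) ^ r"
      using kr by (intro binomial_le_exp) auto
    also have "(exp 1 * real m / real r) ^ r \<le> (exp 1 * real d / 2 / x) ^ r"
    proof (rule power_mono)
      have "real (d * n) = real (2 * m)" by (simp only: assms(3))
      then have meq: "real m = real d * real n / 2" by simp
      have "exp 1 * real m / real r \<le> exp 1 * real m / real k"
        using kr assms(4) by (intro divide_left_mono) auto
      also have "\<dots> = exp 1 * real d / 2 / x"
        unfolding meq x_def using assms(2,4) by simp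
      finally show "exp 1 * real m / real r \<le> exp 1 * real d / 2 / x" .
    qed simp
    finally have few: "real (card (few_split m (d * k) t))
        \<le> (exp 1 * real d / 2 / x) ^ r * (x ^ (2 * r) * real ((2 * m) choose (d * k)))"
      by (simp add: mult_right_mono)
    have "real (n choose k) \<le> (exp 1 / x) ^ k"
      using binomial_le_exp[OF \<open>0 < k\<close>, of n] by (simp add: x_def)
    then have "real (n choose k) * real (card (few_split m (d * k) t))
       \<le> (exp 1 / x) ^ k * ((exp 1 * real d / 2 / x) ^ r * (x ^ (2 * r) * real ((2 * m) choose (d * k))))"
      using few x by (intro mult_mono) auto
    also have "\<dots> = exp 1 ^ k * (exp 1 * real d / 2) ^ r * x ^ (r - k) * real ((2 * m) choose (d * k))"
    proof -
      have "x ^ (2 * r) = x ^ (r - k) * x ^ k * x ^ r"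
        using kr by (simp add: mult_2 flip: power_add)
      then show ?thesis using x by (simp add: power_divide)
    qed
    also have "\<dots> \<le> exp 1 ^ k * (exp 1 * real d / 2) ^ (2 * k) * x powr ((1 + e * real k) / 2) * real ((2 * m) choose (d * k))"
    proof (intro mult_right_mono mult_mono mult_left_mono)
      have "1 * 1 \<le> exp 1 * (real d / 2)"
        using assms by (intro mult_mono) auto
      then show "(exp 1 * real d / 2) ^ r \<le> (exp 1 * real d / 2) ^ (2 * k)"
        using r_le by (intro power_increasing) auto
      have "real (r - k) \<ge> 1" "real (r - k) \<ge> e * real k"
        using kr r_ge by (auto simp: of_nat_diff algebra_simps)
      then have "(1 + e * real k) / 2 \<le> real (r - k)" by simp
      then have "x powr real (r - k) \<le> x powr ((1 + e * real k) / 2)"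
        using x by (intro powr_mono') auto
      then show "x ^ (r - k) \<le> x powr ((1 + e * real k) / 2)" using x by (simp add: powr_realpow)
    qed (use x in auto)
    also have "exp 1 ^ k * (exp 1 * real d / 2) ^ (2 * k) = (exp 1 * (exp 1 * real d / 2) ^ 2) ^ k"
      by (simp add: power_mult power_mult_distrib)
    finally show ?thesis unfolding x_def .
  qed
qed

section \<open>The isoperimetric bound\<close>

definition thin_set :: "nat \<Rightarrow> real \<Rightarrow> real \<Rightarrow> nat set set \<Rightarrow> nat set \<Rightarrow> bool" where
  "thin_set n u l E U \<longleftrightarrow> U \<subseteq> {..<n} \<and> U \<noteq> {} \<and> real (card U) \<le> u * real n \<and>
     real (card (edge_boundary E U)) < l * real (card U)"

lemma edge_iso_number_less_iff:
  assumes "1 \<le> u * real n" "n > 0"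
  shows "\<not> l \<le> edge_iso_number {..<n} E u \<longleftrightarrow> (\<exists>U. thin_set n u l E U)"
proof -
  let ?R = "\<lambda>U. real (card (edge_boundary E U)) / real (card U)"
  let ?P = "\<lambda>U. U \<subseteq> {..<n} \<and> U \<noteq> {} \<and> real (card U) \<le> u * real (card {..<n})"
  have fin: "finite {?R U | U. ?P U}"
    by (rule finite_subset[of _ "?R ` Pow {..<n}"]) auto
  have "?P {0}" using assms by auto
  then have ne: "{?R U | U. ?P U} \<noteq> {}" by blast
  have "l \<le> edge_iso_number {..<n} E u \<longleftrightarrow> (\<forall>U. ?P U \<longrightarrow> l \<le> ?R U)"
    unfolding edge_iso_number_def Min_ge_iff[OF fin ne] by auto
  also have "\<dots> \<longleftrightarrow> (\<forall>U. \<not> thin_set n u l E U)"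
  proof -
    have "l \<le> ?R U \<longleftrightarrow> \<not> real (card (edge_boundary E U)) < l * real (card U)" if "?P U" for U
    proof -
      have "finite U" using that finite_subset by blast
      then have "card U > 0" using that by (simp add: card_gt_0_iff)
      then show ?thesis by (simp add: field_simps not_less)
    qed
    then show ?thesis unfolding thin_set_def by auto
  qed
  finally show ?thesis by simp
qed

text \<open>The union bound over all sets of admissible size.\<close>

lemma card_words_thin_le:
  fixes u l :: real
  assumes "d * n = 2 * m"
  defines "K \<equiv> {k. 0 < k \<and> k \<le> n \<and> real k \<le> u * real n}"
  shows "real (card {w \<in> words n d m. bad_pairs m w = {} \<and> (\<exists>U. thin_set n u l (word_graph m w) U)})
    \<le> real (card (words n d m)) * (\<Sum>k\<in>K. real (n choose k) * real (card (few_split m (d * k) (l * real k)))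
        / real ((2 * m) choose (d * k)))"
proof -
  let ?W = "words n d m"
  let ?A = "\<lambda>k U. {w \<in> ?W. word_pattern m w U \<in> few_split m (d * k) (l * real k)}"
  let ?I = "\<lambda>k. {U. U \<subseteq> {..<n} \<and> card U = k}"
  have finK: "finite K" by (rule finite_subset[of _ "{..n}"]) (auto simp: K_def)
  have finI: "finite (?I k)" for k by (rule finite_subset[of _ "Pow {..<n}"]) auto
  have "{w \<in> ?W. bad_pairs m w = {} \<and> (\<exists>U. thin_set n u l (word_graph m w) U)} \<subseteq> (\<Union>k\<in>K. \<Union>U\<in>?I k. ?A k U)"
  proof safe
    fix w U assume w: "w \<in> ?W" "bad_pairs m w = {}" and U: "thin_set n u l (word_graph m w) U"
    then have U': "U \<subseteq> {..<n}" "U \<noteq> {}" by (auto simp: thin_set_def)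
    then have "finite U" using finite_subset by blast
    then have "card U > 0" using U' by (simp add: card_gt_0_iff)
    moreover have "card U \<le> n" using U' card_mono[of "{..<n}" U] by simp
    ultimately have "card U \<in> K" using U by (simp add: K_def thin_set_def)
    moreover have "w \<in> ?A (card U) U"
      using w U word_pattern_in_patterns[OF w(1) U'(1)] edge_boundary_word_graph[OF w(2), of U]
      by (simp add: few_split_def thin_set_def)
    ultimately show "w \<in> (\<Union>k\<in>K. \<Union>U\<in>?I k. ?A k U)" using U' by blast
  qed
  then have "card {w \<in> ?W. bad_pairs m w = {} \<and> (\<exists>U. thin_set n u l (word_graph m w) U)}
      \<le> card (\<Union>k\<in>K. \<Union>U\<in>?I k. ?A k U)"
    using finK finI by (intro card_mono) auto
  also have "\<dots> \<le> (\<Sum>k\<in>K. card (\<Union>U\<in>?I k. ?A k U))" by (rule card_UN_le[OF finK])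
  also have "\<dots> \<le> (\<Sum>k\<in>K. \<Sum>U\<in>?I k. card (?A k U))" by (intro sum_mono card_UN_le finI)
  finally have "real (card {w \<in> ?W. bad_pairs m w = {} \<and> (\<exists>U. thin_set n u l (word_graph m w) U)})
      \<le> (\<Sum>k\<in>K. \<Sum>U\<in>?I k. real (card (?A k U)))"
    by (simp only: of_nat_le_iff flip: of_nat_sum)
  also have "\<dots> = (\<Sum>k\<in>K. real (card ?W) * (real (n choose k) * real (card (few_split m (d * k) (l * real k)))
        / real ((2 * m) choose (d * k))))"
  proof (rule sum.cong[OF refl])
    fix k assume k: "k \<in> K"
    have "d * k \<le> d * n" using k by (auto simp: K_def)
    then have pos: "((2 * m) choose (d * k)) > 0" using assms by simp
    have "real (card (?A k U)) = real (card (few_split m (d * k) (l * real k))) * real (card ?W) / real ((2 * m) choose (d * k))"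
      if U: "U \<in> ?I k" for U
    proof -
      have "card (?A k U) * ((2 * m) choose (d * k)) = card (few_split m (d * k) (l * real k)) * card ?W"
        using card_words_pattern_in[of U n "few_split m (d * k) (l * real k)" m d] U by (auto simp: few_split_def)
      then have "real (card (?A k U)) * real ((2 * m) choose (d * k)) = real (card (few_split m (d * k) (l * real k))) * real (card ?W)"
        by (simp only: flip: of_nat_mult)
      then show ?thesis using pos by (simp add: field_simps)
    qed
    then have "(\<Sum>U\<in>?I k. real (card (?A k U)))
        = (\<Sum>U\<in>?I k. real (card (few_split m (d * k) (l * real k))) * real (card ?W) / real ((2 * m) choose (d * k)))"
      by (intro sum.cong refl) blast
    also have "\<dots> = real (card ?W) * (real (n choose k) * real (card (few_split m (d * k) (l * real k)))
        / real ((2 * m) choose (d * k)))"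
      using n_subsets[of "{..<n}" k] by simp
    finally show "(\<Sum>U\<in>?I k. real (card (?A k U))) = real (card ?W) * (real (n choose k) * real (card (few_split m (d * k) (l * real k)))
        / real ((2 * m) choose (d * k)))" .
  qed
  finally show ?thesis by (simp only: sum_distrib_left)
qed

text \<open>
  The two estimates are joined at \<open>k = \<delta> n\<close>, with \<open>\<delta>\<close> so small that the base \<open>C (k/n)^(e/2)\<close> of
  the small-set estimate is at most \<open>1/4\<close>.
\<close>

lemma few_split_ratio_bound:
  assumes "d \<ge> 3" "0 < u" "u \<le> 1/2" "0 < l" "l < A_hat d u"
  obtains \<gamma> where "\<gamma> > 0" "\<And>n m k. 0 < n \<Longrightarrow> d * n = 2 * m \<Longrightarrow> 0 < k \<Longrightarrow> real k \<le> u * real n \<Longrightarrow> k \<le> n \<Longrightarrow>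
      real (n choose k) * real (card (few_split m (d * k) (l * real k))) / real ((2 * m) choose (d * k))
      \<le> (1 / 2) ^ k / sqrt (real n) + (real (d * n) + 1) ^ 2 * exp (- \<gamma> * real n)"
proof -
  obtain c where c: "c > 0" and lin: "\<And>s y. 0 < s \<Longrightarrow> s \<le> u \<Longrightarrow> 0 \<le> y \<Longrightarrow> y \<le> l * s \<Longrightarrow> f_hat d s y \<le> - c * s"
    and ld: "l < real d - 2"
    using f_hat_linear_bound[OF assms] by metis
  \<comment> \<open>A set of \<open>k\<close> vertices with fewer than \<open>l k\<close> boundary edges has more than \<open>(d - l) k / 2\<close> inner edges,
    and \<open>e\<close> is chosen with \<open>1 + e \<le> (d - l) / 2\<close>.\<close>
  define e where "e = min 1 ((real d - 2 - l) / 2)"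
  have e: "0 < e" "e \<le> 1" "l \<le> real d - 2 - 2 * e" using ld by (auto simp: e_def min_def field_simps)
  define C where "C = exp 1 * (exp 1 * real d / 2) ^ 2"
  have C: "C > 0" using assms by (simp add: C_def)
  define \<delta> where "\<delta> = (1 / (4 * C)) powr (2 / e)"
  have \<delta>: "\<delta> > 0" using C by (simp add: \<delta>_def)
  show thesis
  proof (rule that[of "c * \<delta>"])
    show "c * \<delta> > 0" using c \<delta> by simp
    fix n m k :: nat
    assume n: "0 < n" and dn: "d * n = 2 * m" and k: "0 < k" "real k \<le> u * real n" "k \<le> n"
    let ?T = "real (n choose k) * real (card (few_split m (d * k) (l * real k)))"
    let ?B = "real ((2 * m) choose (d * k))"
    define x where "x = real k / real n"
    have x: "0 < x" "x \<le> u" using n k by (auto simp: x_def field_simps)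
    have "d * k \<le> d * n" using k by simp
    then have B: "?B > 0" using dn by simp
    have small: "?T / ?B \<le> (1 / 2) ^ k / sqrt (real n)" if "x \<le> \<delta>"
    proof -
      have "?T \<le> C ^ k * x powr ((1 + e * real k) / 2) * ?B"
        unfolding C_def x_def using assms n dn k e by (intro few_split_small mult_right_mono) auto
      then have "?T / ?B \<le> C ^ k * x powr ((1 + e * real k) / 2)"
        using B by (simp add: field_simps)
      also have "x powr ((1 + e * real k) / 2) = sqrt x * (x powr (e / 2)) ^ k"
      proof -
        have "x powr ((1 + e * real k) / 2) = x powr (1 / 2) * x powr (e / 2 * real k)"
          by (simp add: add_divide_distrib flip: powr_add)
        moreover have "x powr (e / 2 * real k) = (x powr (e / 2)) powr real k"
          by (simp only: powr_powr)
        moreover have "(x powr (e / 2)) powr real k = (x powr (e / 2)) ^ k"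
          using x by (intro powr_realpow) simp
        ultimately show ?thesis using x by (simp only: powr_half_sqrt)
      qed
      also have "C ^ k * (sqrt x * (x powr (e / 2)) ^ k) = sqrt x * (C * x powr (e / 2)) ^ k"
        by (simp add: power_mult_distrib)
      also have "\<dots> \<le> sqrt x * (1 / 4) ^ k"
      proof (intro mult_left_mono power_mono)
        have "x powr (e / 2) \<le> \<delta> powr (e / 2)" using x that e by (intro powr_mono2) auto
        also have "\<dots> = 1 / (4 * C)" using e C by (simp add: \<delta>_def powr_powr)
        finally show "C * x powr (e / 2) \<le> 1 / 4" using C by (simp add: field_simps)
      qed (use x C in auto)
      also have "\<dots> = sqrt (real k) * (1 / 4) ^ k / sqrt (real n)" by (simp add: x_def real_sqrt_divide)
      also have "\<dots> \<le> 2 ^ k * (1 / 4) ^ k / sqrt (real n)"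
      proof (intro divide_right_mono mult_right_mono)
        have "sqrt (real k) \<le> sqrt (real k ^ 2)" using k by (intro real_sqrt_le_mono) (simp add: power2_eq_square)
        also have "\<dots> \<le> 2 ^ k" using of_nat_less_two_power[of k] by (simp add: less_imp_le)
        finally show "sqrt (real k) \<le> 2 ^ k" .
      qed auto
      also have "2 ^ k * (1 / 4) ^ k = (1 / 2 :: real) ^ k" by (simp flip: power_mult_distrib)
      finally show ?thesis .
    qed
    have large: "?T / ?B \<le> (real (d * n) + 1) ^ 2 * exp (- (c * \<delta>) * real n)" if "\<delta> \<le> x"
    proof -
      have "?T \<le> real (m + 1) * real (2 * m + 1) * exp (real n * (- c * x)) * ?B"
        unfolding x_def
      proof (rule few_split_large)
        fix y assume "0 \<le> y" "y \<le> l * real k"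
        then show "f_hat d (real k / real n) (y / real n) \<le> - c * (real k / real n)"
          using x n unfolding x_def by (intro lin) (auto simp: field_simps)
      qed (use assms n dn k in auto)
      then have "?T / ?B \<le> real (m + 1) * real (2 * m + 1) * exp (real n * (- c * x))"
        using B by (simp add: field_simps)
      also have "\<dots> \<le> (real (d * n) + 1) * (real (d * n) + 1) * exp (- (c * \<delta>) * real n)"
      proof (intro mult_mono)
        show "real (m + 1) \<le> real (d * n) + 1" "real (2 * m + 1) \<le> real (d * n) + 1"
          unfolding dn by simp_all
        have "c * \<delta> \<le> c * x" using that c by simp
        then have "c * \<delta> * real n \<le> c * x * real n" by (intro mult_right_mono) auto
        then show "exp (real n * (- c * x)) \<le> exp (- (c * \<delta>) * real n)" by (simp add: mult.commute)
      qed auto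
      finally show ?thesis by (simp add: power2_eq_square)
    qed
    have nn: "0 \<le> (1 / 2) ^ k / sqrt (real n)" "0 \<le> (real (d * n) + 1) ^ 2 * exp (- (c * \<delta>) * real n)" by auto
    then show "?T / ?B \<le> (1 / 2) ^ k / sqrt (real n) + (real (d * n) + 1) ^ 2 * exp (- (c * \<delta>) * real n)"
    proof (cases "x \<le> \<delta>")
      case True
      then show ?thesis using small nn(2) by linarith
    next
      case False
      then show ?thesis using large nn(1) by linarith
    qed
  qed
qed

text \<open>Needed because the uniform distribution on the empty set is an unspecified one.\<close>

lemma regular_graphs_eventually_nonempty:
  assumes "d > 0"
  shows "eventually (\<lambda>n. regular_graphs n d \<noteq> {}) (inf at_top (principal {n. even (d * n)}))"
proof -
  obtain c :: real and m0 where c: "c > 0"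
    "\<And>n m. m0 \<le> m \<Longrightarrow> c * real (card (words n d m)) \<le> real (card {w \<in> words n d m. bad_pairs m w = {}})"
    by (rule positive_fraction_simple[OF assms], rule that)
  have "regular_graphs n d \<noteq> {}" if n: "n \<ge> 2 * m0" "even (d * n)" for n
  proof -
    obtain m where m: "d * n = 2 * m" using n by (auto elim: evenE)
    have "n \<le> d * n" using assms by simp
    then have "m0 \<le> m" using n m by linarith
    then have "c * real (card (words n d m)) \<le> real (card {w \<in> words n d m. bad_pairs m w = {}})"
      by (rule c(2))
    moreover have "0 < c * real (card (words n d m))"
      using c(1) words_nonempty[OF m] by (simp add: card_gt_0_iff)
    ultimately have "card {w \<in> words n d m. bad_pairs m w = {}} \<noteq> 0" by linarith
    then have "{w \<in> words n d m. bad_pairs m w = {}} \<noteq> {}"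
      by (rule contrapos_nn) (simp only: card.empty)
    then show ?thesis using word_graph_regular by blast
  qed
  then show ?thesis
    unfolding eventually_inf_principal eventually_at_top_linorder by auto
qed

text \<open>In the sum over \<open>k\<close> the small-set bounds form a geometric series divided by the square root of \<open>n\<close>,
  and the others contribute \<open>n\<close> exponentially small terms.\<close>

lemma aas_edge_iso_number:
  assumes "d \<ge> 3" "0 < u" "u \<le> 1/2" "0 < l" "l < A_hat d u"
  shows "aas d (\<lambda>n E. l \<le> edge_iso_number {..<n} E u)"
proof -
  let ?F = "inf at_top (principal {n. even (d * n)})"
  let ?p = "\<lambda>n. measure_pmf.prob (pmf_of_set (regular_graphs n d)) {E. l \<le> edge_iso_number {..<n} E u}"
  obtain \<gamma> where \<gamma>: "\<gamma> > 0" and bound: "\<And>n m k. 0 < n \<Longrightarrow> d * n = 2 * m \<Longrightarrow> 0 < k \<Longrightarrow> real k \<le> u * real n \<Longrightarrow> k \<le> n \<Longrightarrow>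
      real (n choose k) * real (card (few_split m (d * k) (l * real k))) / real ((2 * m) choose (d * k))
      \<le> (1 / 2) ^ k / sqrt (real n) + (real (d * n) + 1) ^ 2 * exp (- \<gamma> * real n)"
    using few_split_ratio_bound[OF assms] by metis
  have d0: "d > 0" using assms by simp
  obtain c :: real and m0 where c: "c > 0"
    "\<And>n m. m0 \<le> m \<Longrightarrow> c * real (card (words n d m)) \<le> real (card {w \<in> words n d m. bad_pairs m w = {}})"
    by (rule positive_fraction_simple[OF d0], rule that)
  define \<eta> where "\<eta> n = 2 / sqrt (real n) + real n * ((real d * real n + 1) ^ 2 * exp (- \<gamma> * real n))" for n :: nat
  have \<eta>_lim: "\<eta> \<longlonglongrightarrow> 0"
    unfolding \<eta>_def using \<gamma> d0 by real_asymp
  have lower: "1 - \<eta> n / c \<le> ?p n"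
    if n: "n > 0" "1 \<le> u * real n" "n \<ge> 2 * m0" "even (d * n)" and ne: "regular_graphs n d \<noteq> {}" for n
  proof -
    let ?G = "regular_graphs n d"
    let ?Q = "\<lambda>E. \<exists>U. thin_set n u l E U"
    obtain m where m: "d * n = 2 * m" using n by (auto elim: evenE)
    have "n \<le> d * n" using d0 by simp
    then have "m0 \<le> m" using n m by linarith
    then have frac: "c * real (card (words n d m)) \<le> real (card {w \<in> words n d m. bad_pairs m w = {}})"
      using c by blast
    have N: "real (card (words n d m)) > 0" using words_nonempty[OF m] by (simp add: card_gt_0_iff)
    define K where "K = {k. 0 < k \<and> k \<le> n \<and> real k \<le> u * real n}"
    have finK: "finite K" by (rule finite_subset[of _ "{..n}"]) (auto simp: K_def)
    define S where "S = (\<Sum>k\<in>K. real (n choose k) * real (card (few_split m (d * k) (l * real k)))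
        / real ((2 * m) choose (d * k)))"
    have "S \<le> (\<Sum>k\<in>K. (1 / 2) ^ k / sqrt (real n) + (real (d * n) + 1) ^ 2 * exp (- \<gamma> * real n))"
      unfolding S_def using n m by (intro sum_mono bound) (auto simp: K_def)
    also have "\<dots> = (\<Sum>k\<in>K. (1 / 2) ^ k) / sqrt (real n) + real (card K) * ((real (d * n) + 1) ^ 2 * exp (- \<gamma> * real n))"
      by (simp add: sum.distrib sum_divide_distrib)
    also have "\<dots> \<le> 2 / sqrt (real n) + real n * ((real (d * n) + 1) ^ 2 * exp (- \<gamma> * real n))"
    proof (intro add_mono divide_right_mono mult_right_mono)
      have "(\<Sum>k\<in>K. (1 / 2) ^ k) \<le> (\<Sum>k. (1 / 2 :: real) ^ k)"
        using finK by (intro sum_le_suminf summable_geometric) auto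
      then show "(\<Sum>k\<in>K. (1 / 2) ^ k) \<le> (2 :: real)" by (simp add: suminf_geometric)
      have "K \<subseteq> {1..n}" by (auto simp: K_def)
      then have "card K \<le> n" using card_mono[of "{1..n}" K] by simp
      then show "real (card K) \<le> real n" by simp
    qed auto
    finally have S: "S \<le> \<eta> n" by (simp add: \<eta>_def)
    have bad: "real (card {w \<in> words n d m. bad_pairs m w = {} \<and> ?Q (word_graph m w)}) \<le> real (card (words n d m)) * S"
      unfolding S_def K_def by (rule card_words_thin_le[OF m])
    define a where "a = real (card {E \<in> ?G. ?Q E})"
    define g where "g = real (card ?G)"
    define W where "W = real (card {w \<in> words n d m. bad_pairs m w = {}})"
    have g: "g > 0" using ne by (simp add: g_def card_gt_0_iff)
    have "a * W = real (card {w \<in> words n d m. bad_pairs m w = {} \<and> ?Q (word_graph m w)}) * g"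
      unfolding a_def W_def g_def using card_graphs_words[of n d ?Q m] by (simp only: flip: of_nat_mult)
    also have "\<dots> \<le> real (card (words n d m)) * S * g"
      using bad g by (intro mult_right_mono) auto
    finally have 1: "a * W \<le> real (card (words n d m)) * S * g" .
    have "a * (c * real (card (words n d m))) \<le> a * W"
      using frac by (intro mult_left_mono) (auto simp: a_def W_def)
    with 1 have "(a * c) * real (card (words n d m)) \<le> (S * g) * real (card (words n d m))"
      by (simp add: ac_simps)
    then have "a * c \<le> S * g" using N by simp
    then have "a / g \<le> S / c" using g c by (simp add: field_simps)
    also have "\<dots> \<le> \<eta> n / c" using S c by (simp add: divide_right_mono)
    finally have ag: "a / g \<le> \<eta> n / c" .
    have "measure_pmf.prob (pmf_of_set ?G) {E. ?Q E} = a / g"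
      using ne by (simp add: measure_pmf_of_set a_def g_def Int_def)
    moreover have "{E. l \<le> edge_iso_number {..<n} E u} = - {E. ?Q E}"
      using edge_iso_number_less_iff[OF n(2,1), of l] by auto
    ultimately have "?p n = 1 - a / g"
      using measure_pmf.prob_compl[of "{E. ?Q E}" "pmf_of_set ?G"] by (simp add: Compl_eq_Diff_UNIV)
    then show ?thesis using ag by simp
  qed
  have ev: "eventually (\<lambda>n. 1 - \<eta> n / c \<le> ?p n) ?F"
  proof -
    have "eventually (\<lambda>n. n > 0 \<and> 1 \<le> u * real n \<and> n \<ge> 2 * m0) at_top"
    proof (intro eventually_conj)
      show "eventually (\<lambda>n. 1 \<le> u * real n) at_top" using assms(2) by real_asymp
    qed (auto intro: eventually_gt_at_top eventually_ge_at_top)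
    then have "eventually (\<lambda>n. n > 0 \<and> 1 \<le> u * real n \<and> n \<ge> 2 * m0) ?F"
      by (rule filter_leD[OF inf_le1])
    moreover have "eventually (\<lambda>n. even (d * n)) ?F"
      by (simp add: eventually_inf_principal)
    ultimately show ?thesis using regular_graphs_eventually_nonempty[OF d0]
      by eventually_elim (use lower in blast)
  qed
  have "((\<lambda>n. 1 - \<eta> n / c) \<longlongrightarrow> 1 - 0 / c) at_top"
    using c by (intro tendsto_intros \<eta>_lim) auto
  then have lim: "((\<lambda>n. 1 - \<eta> n / c) \<longlongrightarrow> 1) ?F" by (auto intro: tendsto_mono[OF inf_le1])
  have "(?p \<longlongrightarrow> 1) ?F"
    by (rule tendsto_sandwich[OF ev _ lim tendsto_const]) auto
  then show ?thesis unfolding aas_def .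
qed

text \<open>
  A single vertex has boundary at most \<open>d\<close>. This makes the set of admissible \<open>l\<close> bounded, so that its
  supremum is an upper bound.
\<close>

lemma aas_edge_iso_number_le_degree:
  assumes "d > 0" "0 < u" "aas d (\<lambda>n E. l \<le> edge_iso_number {..<n} E u)"
  shows "l \<le> real d"
proof (rule ccontr)
  assume l: "\<not> l \<le> real d"
  let ?F = "inf at_top (principal {n. even (d * n)})"
  let ?p = "\<lambda>n. measure_pmf.prob (pmf_of_set (regular_graphs n d)) {E. l \<le> edge_iso_number {..<n} E u}"
  have zero: "?p n = 0" if n: "n > 0" "1 \<le> u * real n" and ne: "regular_graphs n d \<noteq> {}" for n
  proof -
    have "thin_set n u l E {0}" if E: "E \<in> regular_graphs n d" for E
    proof -
      have "0 \<in> e" if "card (e \<inter> {0}) = 1" for e :: "nat set"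
        using that by (cases "0 \<in> e") simp_all
      then have "edge_boundary E {0} \<subseteq> {e \<in> E. 0 \<in> e}"
        unfolding edge_boundary_def by blast
      then have "card (edge_boundary E {0}) \<le> card {e \<in> E. 0 \<in> e}"
        using regular_graphs_finite_edges[OF E] by (intro card_mono) simp_all
      also have "\<dots> = d" using E n by (auto simp: regular_graphs_def vertex_degree_def)
      finally show ?thesis using l n by (simp add: thin_set_def)
    qed
    then have "regular_graphs n d \<inter> {E. l \<le> edge_iso_number {..<n} E u} = {}"
      using edge_iso_number_less_iff[OF n(2,1), of l] by blast
    then show ?thesis using ne by (simp add: measure_pmf_of_set)
  qed
  have "eventually (\<lambda>n. n > 0 \<and> 1 \<le> u * real n) at_top"
  proof (intro eventually_conj)
    show "eventually (\<lambda>n. 1 \<le> u * real n) at_top" using assms(2) by real_asymp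
  qed (auto intro: eventually_gt_at_top)
  then have "eventually (\<lambda>n. n > 0 \<and> 1 \<le> u * real n) ?F"
    by (rule filter_leD[OF inf_le1])
  then have "eventually (\<lambda>n. ?p n = 0) ?F"
    using regular_graphs_eventually_nonempty[OF assms(1)] by eventually_elim (use zero in blast)
  then have "(?p \<longlongrightarrow> 0) ?F" by (rule tendsto_eventually)
  moreover have "(?p \<longlongrightarrow> 1) ?F" using assms(3) by (simp add: aas_def)
  moreover have "?F \<noteq> bot"
  proof
    assume "?F = bot"
    then have "eventually (\<lambda>n. False) ?F" by simp
    then obtain N where "\<forall>n\<ge>N. \<not> even (d * n)"
      unfolding eventually_inf_principal eventually_at_top_linorder by auto
    then have "\<not> even (d * (2 * N))" by (rule allE[of _ "2 * N"]) (simp only: mult_2 le_add1 simp_thms)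
    then show False by simp
  qed
  ultimately have "(0 :: real) = 1" using tendsto_unique by blast
  then show False by simp
qed

theorem theorem3:
  fixes d :: nat and u :: real
  assumes "d \<ge> 3" and "0 < u" and "u \<le> 1 / 2"
  shows "\<exists>y. is_smallest_positive_solution d u y \<and>
             edge_iso_const u d \<ge> A_hat d u \<and> A_hat d u = y / u"
proof -
  obtain y where y: "is_smallest_positive_solution d u y" "A_hat d u = y / u" "0 < y"
    using smallest_solution[OF assms] by metis
  have "A_hat d u \<le> edge_iso_const u d"
  proof (rule dense_le_bounded)
    show "0 < A_hat d u" using y assms by simp
    fix l assume "0 < l" "l < A_hat d u"
    then have "l \<in> {l. aas d (\<lambda>n E. l \<le> edge_iso_number {..<n} E u)}"
      using aas_edge_iso_number[OF assms] by simp
    moreover have "bdd_above {l. aas d (\<lambda>n E. l \<le> edge_iso_number {..<n} E u)}"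
      using aas_edge_iso_number_le_degree[of d u] assms by (intro bdd_aboveI[of _ "real d"]) auto
    ultimately show "l \<le> edge_iso_const u d"
      unfolding edge_iso_const_def by (rule cSup_upper)
  qed
  with y show ?thesis by blast
qed

end
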